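(* For $y\in(0,\pi/4)$ let $c_0=\tfrac{1}{\sqrt2}(\cos^2y+i\sin^2y)$, $c_1=\tfrac{1}{\sqrt2}(\sin^2y+i\cos^2y)$, $c_2=c_3=\tfrac{1}{\sqrt2}(1+i)\sin y\cos y$, and $U=\sum_{j=0}^3c_j\sigma_j\otimes\sigma_j$. Then $$K_E(U)=H(|c_0|^2,|c_0|^2,|c_2|^2,|c_2|^2)=H\big(\tfrac12(\cos^4y+\sin^4y),\tfrac12(\cos^4y+\sin^4y),\sin^2y\cos^2y,\sin^2y\cos^2y\big)\ \text{ebits},$$ attained by the input state $\frac{1}{\sqrt2}(|00\rangle+|11\rangle)_{AR_A}\otimes\frac{1}{\sqrt2}(|00\rangle+|11\rangle)_{BR_B}$.
   Context: Pauli matrices: $\sigma_0=I$, $\sigma_1=\begin{pmatrix}0&1\\1&0\end{pmatrix}$, $\sigma_2=\begin{pmatrix}0&-i\\i&0\end{pmatrix}$, $\sigma_3=\begin{pmatrix}1&0\\0&-1\end{pmatrix}$; $U$ acts on qubits $A,B$. The entangling power is $K_E(U)=\max E\big(U(|\phi\rangle_{AR_A}\otimes|\psi\rangle_{BR_B})\big)$, the maximum over pure states on $AR_A$ and $BR_B$ with arbitrary finite-dimensional ancillas $R_A,R_B$ ($U$ acting on $A,B$), where $E(|\chi\rangle)=S(\mathrm{Tr}_{AR_A}|\chi\rangle\langle\chi|)$ is the von Neumann entropy, base-2 logarithm (ebits). $H$ is the base-2 Shannon entropy. *)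

theory Defs
  imports "Jordan_Normal_Form.Char_Poly"
          "HOL-Computational_Algebra.Fundamental_Theorem_Algebra"
begin

definition pauli :: "nat \<Rightarrow> complex mat" where
  "pauli j = (if j = 0 then mat_of_rows_list 2 [[1, 0], [0, 1]]
     else if j = 1 then mat_of_rows_list 2 [[0, 1], [1, 0]]
     else if j = 2 then mat_of_rows_list 2 [[0, -\<i>], [\<i>, 0]]
     else mat_of_rows_list 2 [[1, 0], [0, -1]])"

text \<open>Kronecker (tensor) product; the row/column index of A is the more significant one,
  i.e. basis vector |x y> has index x * (dim of second factor) + y.\<close>
definition kron :: "complex mat \<Rightarrow> complex mat \<Rightarrow> complex mat" where
  "kron A B = mat (dim_row A * dim_row B) (dim_col A * dim_col B)
     (\<lambda>(i, j). A $$ (i div dim_row B, j div dim_col B) * B $$ (i mod dim_row B, j mod dim_col B))"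

definition pure_state :: "nat \<Rightarrow> complex vec \<Rightarrow> bool" where
  "pure_state n v \<longleftrightarrow> dim_vec v = n \<and> (\<Sum>i<n. (cmod (v $ i))\<^sup>2) = 1"

text \<open>Base-2 Shannon entropy of a finite probability list (with 0 log 0 = 0,
  which holds automatically since log 2 0 = 0 in Isabelle).\<close>
definition shannon_entropy :: "real list \<Rightarrow> real" where
  "shannon_entropy ps = (\<Sum>p\<leftarrow>ps. - p * log 2 p)"

text \<open>Von Neumann entropy (base 2) of a density matrix: Shannon entropy of its eigenvalues,
  counted with algebraic multiplicity (roots of the characteristic polynomial).\<close>
definition vn_entropy :: "complex mat \<Rightarrow> real" where
  "vn_entropy \<rho> = sum_mset (image_mset (\<lambda>e. - Re e * log 2 (Re e)) (proots (char_poly \<rho>)))"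

text \<open>System ordering A, R_A, B, R_B with dim A = dim B = 2, dim R_A = dA, dim R_B = dB.
  phi is a state on A R_A (index a * dA + r), psi a state on B R_B (index b * dB + s);
  U is a 4x4 unitary on A B (index a * 2 + b).
  The output state (U on AB) is stored as the amplitude function
  chi (a, r, b, s).\<close>
definition output_amp ::
  "complex mat \<Rightarrow> nat \<Rightarrow> nat \<Rightarrow> complex vec \<Rightarrow> complex vec \<Rightarrow> nat \<Rightarrow> nat \<Rightarrow> nat \<Rightarrow> nat \<Rightarrow> complex" where
  "output_amp U dA dB phi psi a r b s =
     (\<Sum>a'<2. \<Sum>b'<2. U $$ (a * 2 + b, a' * 2 + b') * phi $ (a' * dA + r) * psi $ (b' * dB + s))"

text \<open>Reduced density matrix on B R_B (partial trace over A R_A) of the output state;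
  rows/columns indexed by b * dB + s.\<close>
definition reduced_BRB ::
  "complex mat \<Rightarrow> nat \<Rightarrow> nat \<Rightarrow> complex vec \<Rightarrow> complex vec \<Rightarrow> complex mat" where
  "reduced_BRB U dA dB phi psi = mat (2 * dB) (2 * dB) (\<lambda>(j, j').
     \<Sum>a<2. \<Sum>r<dA.
       output_amp U dA dB phi psi a r (j div dB) (j mod dB)
       * cnj (output_amp U dA dB phi psi a r (j' div dB) (j' mod dB)))"

definition output_entanglement ::
  "complex mat \<Rightarrow> nat \<Rightarrow> nat \<Rightarrow> complex vec \<Rightarrow> complex vec \<Rightarrow> real" where
  "output_entanglement U dA dB phi psi = vn_entropy (reduced_BRB U dA dB phi psi)"

definition entangling_values :: "complex mat \<Rightarrow> real set" where
  "entangling_values U = {output_entanglement U dA dB phi psi | dA dB phi psi.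
      dA \<ge> 1 \<and> dB \<ge> 1 \<and> pure_state (2 * dA) phi \<and> pure_state (2 * dB) psi}"

definition entangling_power :: "complex mat \<Rightarrow> real" where
  "entangling_power U = Sup (entangling_values U)"

definition bell :: "complex vec" where
  "bell = vec 4 (\<lambda>i. if i = 0 \<or> i = 3 then complex_of_real (1 / sqrt 2) else 0)"

end

theory Submission
  imports Defs "Jordan_Normal_Form.Schur_Decomposition" "HOL-Real_Asymp.Real_Asymp"
begin

text \<open>
  Put \<open>C = cos 2y\<close>. Let \<open>\<rho>\<close> be the output state on \<open>B R\<^sub>B\<close>. Averaging \<open>\<rho>\<close> with its conjugate under the
  Pauli matrix \<open>X\<close> on \<open>B\<close> does not decrease the entropy, and splits the state into two blocks
  \<open>\<Psi> M\<^sub>0 \<Psi>\<^sup>\<dagger>\<close> and \<open>\<Psi> M\<^sub>1 \<Psi>\<^sup>\<dagger>\<close>, where \<open>\<Psi>\<close> is the amplitude matrix of the input on \<open>B R\<^sub>B\<close> and the positive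
  2x2 matrices \<open>M\<^sub>0, M\<^sub>1\<close> depend only on \<open>U\<close> and on the input on \<open>A R\<^sub>A\<close>. Unitarity gives
  \<open>M\<^sub>0 + M\<^sub>1 = 1\<close>, so both are diagonal in a common eigenbasis; with \<open>\<mu>\<^sub>0, \<mu>\<^sub>1\<close> the eigenvalues of \<open>M\<^sub>0\<close>, the
  blocks become an ensemble of four vectors with weights \<open>\<mu>\<^sub>l r\<^sub>l\<close> and \<open>(1 - \<mu>\<^sub>l) r\<^sub>l\<close>, whose Shannon
  entropy bounds that of \<open>\<rho>\<close>. The off-diagonal entry of \<open>M\<^sub>0\<close> has real part \<open>C\<^sup>2/2\<close> for every input, hence
  \<open>\<bar>\<mu>\<^sub>0 - \<mu>\<^sub>1\<bar> \<ge> C\<^sup>2\<close>. Optimising over \<open>r\<^sub>0 + r\<^sub>1 = 1\<close> turns the Shannon entropy into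
  \<open>ln (exp h(\<mu>\<^sub>0) + exp h(\<mu>\<^sub>1))\<close>, \<open>h\<close> the binary entropy, and concavity of \<open>exp h\<close> together with the gap
  yields the bound \<open>1 + h((1 - C\<^sup>2)/2)\<close> in bits, which is the claimed value.
\<close>

section \<open>Scalar entropy inequalities\<close>

definition ent :: "real \<Rightarrow> real" where
  "ent x = - x * log 2 x"

lemma ent_0 [simp]: "ent 0 = 0"
  by (simp add: ent_def)

text \<open>Concavity of \<open>ent\<close> combined with \<open>ent 0 = 0\<close>: the missing mass
  \<open>1 - sum p J\<close> can be placed at the point 0, where it contributes nothing, so
  subprobability weights suffice. The analytic input is only \<open>ln t \<le> t - 1\<close> at
  \<open>t = w / l j\<close>.\<close>

lemma ent_jensen:
  fixes p l :: "'a \<Rightarrow> real"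
  assumes fin: "finite J" and p: "\<And>j. j \<in> J \<Longrightarrow> 0 \<le> p j" and l: "\<And>j. j \<in> J \<Longrightarrow> 0 \<le> l j"
    and sp: "sum p J \<le> 1"
  shows "(\<Sum>j\<in>J. p j * ent (l j)) \<le> ent (\<Sum>j\<in>J. p j * l j)"
proof -
  define w where "w = (\<Sum>j\<in>J. p j * l j)"
  have w0: "w \<ge> 0" unfolding w_def by (intro sum_nonneg) (use p l in auto)
  show ?thesis
  proof (cases "w = 0")
    case True
    hence "\<forall>j\<in>J. p j * l j = 0"
      unfolding w_def using p l by (subst (asm) sum_nonneg_eq_0_iff) (auto simp: fin)
    hence "(\<Sum>j\<in>J. p j * ent (l j)) = 0"
      by (intro sum.neutral) (auto simp: ent_def)
    with True show ?thesis by (simp add: w_def[symmetric])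
  next
    case False
    hence wp: "w > 0" using w0 by simp
    have term_le: "p j * (l j * (ln w - ln (l j))) \<le> p j * w - p j * l j" if j: "j \<in> J" for j
    proof (cases "l j = 0")
      case True
      then show ?thesis using p[OF j] wp by simp
    next
      case False
      hence lp: "l j > 0" using l[OF j] by simp
      have "ln w - ln (l j) = ln (w / l j)" using wp lp by (simp add: ln_div)
      also have "\<dots> \<le> w / l j - 1" using wp lp by (intro ln_le_minus_one) simp
      finally have "l j * (ln w - ln (l j)) \<le> l j * (w / l j - 1)"
        using lp by (intro mult_left_mono) auto
      also have "\<dots> = w - l j" using lp by (simp add: field_simps)
      finally show ?thesis using mult_left_mono[OF _ p[OF j]] by (fastforce simp: algebra_simps)
    qed
    have "(\<Sum>j\<in>J. p j * (l j * (ln w - ln (l j)))) \<le> (\<Sum>j\<in>J. p j * w - p j * l j)"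
      by (rule sum_mono) (rule term_le)
    also have "\<dots> = sum p J * w - w"
      by (simp add: sum_subtractf sum_distrib_right w_def)
    also have "\<dots> \<le> 0" using sp wp by (simp add: mult_le_cancel_right2)
    finally have "(\<Sum>j\<in>J. p j * (l j * (ln w - ln (l j)))) \<le> 0" .
    moreover have "(\<Sum>j\<in>J. p j * (l j * (ln w - ln (l j))))
        = w * ln w + (\<Sum>j\<in>J. p j * (- l j * ln (l j)))"
      unfolding w_def[symmetric]
      by (simp add: algebra_simps sum_subtractf sum_negf)
         (simp add: w_def sum_distrib_right sum_distrib_left mult_ac)
    ultimately have "(\<Sum>j\<in>J. p j * (- l j * ln (l j))) \<le> - w * ln w" by simp
    hence "(\<Sum>j\<in>J. p j * (- l j * ln (l j))) / ln 2 \<le> - w * ln w / ln 2"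
      by (intro divide_right_mono) auto
    thus ?thesis
      unfolding w_def[symmetric] ent_def log_def by (simp add: sum_divide_distrib)
  qed
qed

text \<open>Binary entropy in nats: \<open>exp\<close> is then the natural exponential and
  derivatives carry no factor \<open>ln 2\<close>. Conversion to bits is
  \<open>ent_add_hb\<close>.\<close>

definition hb :: "real \<Rightarrow> real" where
  "hb x = - x * ln x - (1 - x) * ln (1 - x)"

lemma hb_sym: "hb (1 - x) = hb x"
  by (simp add: hb_def algebra_simps)

lemma hb_has_derivative:
  assumes "0 < x" "x < 1"
  shows "(hb has_real_derivative (ln (1 - x) - ln x)) (at x)"
  unfolding hb_def using assms
  by (auto intro!: derivative_eq_intros)

text \<open>Only the endpoints need an argument; there it is the limit of \<open>x * ln x\<close> at
  0 from the right, reflected by \<open>x \<mapsto> 1 - x\<close> for the other end.\<close>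

lemma continuous_on_hb: "continuous_on {0..1} hb"
proof -
  have *: "continuous_on {0..1::real} (\<lambda>x. x * ln x)"
  proof (rule continuous_on_eq_continuous_within[THEN iffD2], rule ballI)
    fix x :: real assume x: "x \<in> {0..1}"
    show "continuous (at x within {0..1}) (\<lambda>x. x * ln x)"
    proof (cases "x = 0")
      case True
      have "((\<lambda>x::real. x * ln x) \<longlongrightarrow> 0) (at_right 0)" by real_asymp
      hence "((\<lambda>x::real. x * ln x) \<longlongrightarrow> 0) (at 0 within {0..1})"
        by (simp add: at_within_Icc_at_right)
      thus ?thesis using True by (simp add: continuous_within)
    next
      case False
      thus ?thesis using x by (intro continuous_intros) auto
    qed
  qed
  have "continuous_on {0..1::real} ((\<lambda>x. x * ln x) \<circ> (\<lambda>x. 1 - x))"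
    by (intro continuous_on_compose continuous_intros continuous_on_subset[OF *]) auto
  thus ?thesis unfolding hb_def using * by (auto simp: o_def intro!: continuous_intros)
qed

text \<open>This decides the sign of the second derivative of \<open>exp hb\<close>, which is
  \<open>exp hb * (hb'^2 + hb'')\<close> with \<open>hb' = ln (1 - x) - ln x\<close> and
  \<open>hb'' = - 1 / (x * (1 - x))\<close>. In the variable \<open>u = hb'\<close> the right-hand
  side becomes \<open>2 + exp u + exp (-u)\<close>.\<close>

lemma ln_ratio_sq_le:
  fixes x :: real
  assumes "0 < x" "x < 1"
  shows "(ln (1 - x) - ln x)\<^sup>2 \<le> 1 / (x * (1 - x))"
proof -
  define u where "u = ln (1 - x) - ln x"
  have e: "exp u = (1 - x) / x" using assms by (simp add: u_def exp_diff)
  have "1 / (x * (1 - x)) = 2 + exp u + exp (-u)"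
    unfolding exp_minus e using assms by (simp add: field_simps power2_eq_square)
  also have "\<dots> \<ge> u\<^sup>2"
  proof -
    \<comment> \<open>Already \<open>v \<le> exp (v / 2)\<close>: the quadratic Taylor polynomial of
      \<open>exp (v / 2)\<close> exceeds \<open>v\<close> by
      \<open>((v - 2)^2 + 4) / 8\<close>.\<close>
    have *: "v\<^sup>2 \<le> 2 + exp v + exp (-v)" if "v \<ge> 0" for v :: real
    proof -
      have "v \<le> 1 + v / 2 + (v / 2)\<^sup>2 / 2"
        using zero_le_power2[of "v - 2"] by (simp add: power2_eq_square algebra_simps)
      also have "\<dots> \<le> exp (v / 2)"
        using that by (intro exp_lower_Taylor_quadratic) simp
      finally have "v\<^sup>2 \<le> (exp (v / 2))\<^sup>2" using that by (intro power_mono)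
      also have "\<dots> = exp v" by (simp flip: exp_double)
      finally show ?thesis using exp_gt_zero[of "-v"] by linarith
    qed
    show ?thesis
    proof (cases "u \<ge> 0")
      case True thus ?thesis by (rule *)
    next
      case False thus ?thesis using *[of "-u"] by simp
    qed
  qed
  finally show ?thesis by (simp add: u_def)
qed

text \<open>The derivative \<open>G'\<close> decreases on the open interval by
  \<open>ln_ratio_sq_le\<close>, so moving two arguments apart symmetrically about their midpoint
  lowers the sum. Derivatives are used in the interior only; continuity of \<open>hb\<close> covers
  the endpoints.\<close>

lemma exp_hb_midpoint_concave:
  assumes "0 \<le> x1" "x1 \<le> 1" "0 \<le> x2" "x2 \<le> 1"
  shows "exp (hb x1) + exp (hb x2) \<le> 2 * exp (hb ((x1 + x2) / 2))"
proof -
  define G' where "G' = (\<lambda>x. exp (hb x) * (ln (1 - x) - ln x))"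
  have G': "((\<lambda>x. exp (hb x)) has_real_derivative G' x) (at x)" if "0 < x" "x < 1" for x
    unfolding G'_def using hb_has_derivative[OF that] by (auto intro!: derivative_eq_intros)
  have G'_mono: "G' v \<le> G' u" if "0 < u" "u \<le> v" "v < 1" for u v
  proof (rule DERIV_nonpos_imp_nonincreasing[OF \<open>u \<le> v\<close>])
    fix x assume "u \<le> x" "x \<le> v"
    hence x: "0 < x" "x < 1" using that by auto
    let ?d = "exp (hb x) * ((ln (1 - x) - ln x)\<^sup>2 - 1 / (x * (1 - x)))"
    have "(G' has_real_derivative ?d) (at x)"
      unfolding G'_def using x hb_has_derivative[OF x]
      by (auto intro!: derivative_eq_intros simp: field_simps power2_eq_square)
    moreover have "?d \<le> 0"
      using ln_ratio_sq_le[OF x] by (simp add: mult_le_0_iff)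
    ultimately show "\<exists>d. (G' has_real_derivative d) (at x) \<and> d \<le> 0" by blast
  qed
  have main: "exp (hb (m + t)) + exp (hb (m - t)) \<le> 2 * exp (hb m)"
    if t: "0 \<le> t" "0 \<le> m - t" "m + t \<le> 1" for m t
  proof -
    let ?g = "\<lambda>u. exp (hb (m + u)) + exp (hb (m - u))"
    have cont: "continuous_on {0..t} ?g"
    proof -
      have "continuous_on {0..t} (hb \<circ> (\<lambda>u. m + u))" "continuous_on {0..t} (hb \<circ> (\<lambda>u. m - u))"
        using t by (intro continuous_on_compose continuous_intros continuous_on_subset[OF continuous_on_hb]; force)+
      thus ?thesis by (auto simp: o_def intro!: continuous_intros)
    qed
    have "?g t \<le> ?g 0"
    proof (rule DERIV_nonpos_imp_decreasing_open[OF t(1) _ cont])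
      fix u assume u: "0 < u" "u < t"
      have "(?g has_real_derivative (G' (m + u) - G' (m - u))) (at u)"
      proof -
        have "((\<lambda>u. exp (hb (m + u))) has_real_derivative G' (m + u) * 1) (at u)"
          by (rule DERIV_chain2[of "\<lambda>x. exp (hb x)", OF G'])
             (use u t in \<open>auto intro!: derivative_eq_intros\<close>)
        moreover have "((\<lambda>u. exp (hb (m - u))) has_real_derivative G' (m - u) * (-1)) (at u)"
          by (rule DERIV_chain2[of "\<lambda>x. exp (hb x)", OF G'])
             (use u t in \<open>auto intro!: derivative_eq_intros\<close>)
        ultimately show ?thesis using DERIV_add by fastforce
      qed
      moreover have "G' (m + u) - G' (m - u) \<le> 0" using G'_mono[of "m - u" "m + u"] u t by simp
      ultimately show "\<exists>y. (?g has_real_derivative y) (at u) \<and> y \<le> 0" by blast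
    qed
    thus ?thesis by simp
  qed
  show ?thesis
  proof (cases "x1 \<le> x2")
    case True
    have "(x1 + x2) / 2 + (x2 - x1) / 2 = x2" "(x1 + x2) / 2 - (x2 - x1) / 2 = x1"
      by (simp_all add: field_simps)
    thus ?thesis using main[of "(x2 - x1) / 2" "(x1 + x2) / 2"] True assms by (simp add: add.commute)
  next
    case False
    have "(x1 + x2) / 2 + (x1 - x2) / 2 = x1" "(x1 + x2) / 2 - (x1 - x2) / 2 = x2"
      by (simp_all add: field_simps)
    thus ?thesis using main[of "(x1 - x2) / 2" "(x1 + x2) / 2"] False assms by simp
  qed
qed

lemma hb_mono:
  assumes "0 \<le> u" "u \<le> v" "v \<le> 1 / 2"
  shows "hb u \<le> hb v"
proof (rule DERIV_nonneg_imp_increasing_open[OF assms(2)])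
  show "continuous_on {u..v} hb"
    by (rule continuous_on_subset[OF continuous_on_hb]) (use assms in auto)
  fix x assume x: "u < x" "x < v"
  hence "ln x \<le> ln (1 - x)" using assms by (subst ln_le_cancel_iff) auto
  thus "\<exists>y. (hb has_real_derivative y) (at x) \<and> 0 \<le> y"
    using hb_has_derivative[of x] x assms by (intro exI[of _ "ln (1 - x) - ln x"]) auto
qed

lemma ent_mult:
  assumes "0 \<le> x" "0 \<le> z"
  shows "ent (x * z) = z * ent x + x * ent z"
  using assms by (cases "x = 0 \<or> z = 0") (auto simp: ent_def log_mult algebra_simps)

lemma ent_add_hb: "ent x + ent (1 - x) = hb x / ln 2"
  by (simp add: ent_def hb_def log_def field_simps)

text \<open>Gibbs variational principle: the relative entropy of \<open>(r0, r1)\<close> with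
  respect to the weights \<open>exp a / ?Z\<close>, \<open>exp b / ?Z\<close> is nonnegative. It is
  summed from two tangent-line estimates of \<open>ln\<close>.\<close>

lemma gibbs_two:
  fixes r0 r1 a b :: real
  assumes r: "0 \<le> r0" "0 \<le> r1" "r0 + r1 = 1"
  shows "hb r0 + r0 * a + r1 * b \<le> ln (exp a + exp b)"
proof -
  let ?Z = "exp a + exp b"
  have Z: "?Z > 0" by (simp add: add_pos_pos)
  have *: "- t * ln t + t * x - t * ln ?Z \<le> exp x / ?Z - t" if "0 \<le> t" for t x :: real
  proof (cases "t = 0")
    case False
    hence t: "t > 0" using that by simp
    have "- ln t + x - ln ?Z = ln (exp x / (t * ?Z))"
      using t Z by (simp add: ln_div ln_mult)
    also have "\<dots> \<le> exp x / (t * ?Z) - 1" using t Z by (intro ln_le_minus_one) simp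
    finally have "t * (- ln t + x - ln ?Z) \<le> t * (exp x / (t * ?Z) - 1)"
      using t by (intro mult_left_mono) auto
    also have "t * (exp x / (t * ?Z) - 1) = exp x / ?Z - t"
      using t by (simp add: right_diff_distrib)
    finally show ?thesis by (simp add: algebra_simps)
  qed (use Z in simp)
  have "r1 = 1 - r0" using r by simp
  have "exp a / ?Z + exp b / ?Z = 1" using Z by (simp flip: add_divide_distrib)
  moreover have "r0 * ln ?Z + r1 * ln ?Z = ln ?Z" using r by (simp flip: distrib_right)
  ultimately show ?thesis using *[OF r(1), of a] *[OF r(2), of b] r
    unfolding hb_def \<open>r1 = 1 - r0\<close>[symmetric] by linarith
qed

text \<open>The chain rule writes the four-weight entropy as
  \<open>hb r0 + r0 * hb m0 + r1 * hb m1\<close> in nats; \<open>gibbs_two\<close> removes the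
  \<open>r\<close>, concavity of \<open>exp hb\<close> the \<open>m\<close>. Equality holds at
  \<open>r0 = r1 = 1 / 2\<close>, \<open>m0 = (1 + k) / 2\<close>,
  \<open>m1 = (1 - k) / 2\<close>.\<close>

lemma pinched_entropy_le:
  fixes k m0 m1 r0 r1 :: real
  assumes m: "0 \<le> m0" "m0 \<le> 1" "0 \<le> m1" "m1 \<le> 1"
    and r: "0 \<le> r0" "0 \<le> r1" "r0 + r1 = 1"
    and k: "0 \<le> k" "k \<le> \<bar>m0 - m1\<bar>"
  shows "ent (m0 * r0) + ent ((1 - m0) * r0) + ent (m1 * r1) + ent ((1 - m1) * r1)
    \<le> 2 * ent ((1 + k) / 4) + 2 * ent ((1 - k) / 4)"
proof -
  have pair: "ent (m * r) + ent ((1 - m) * r) = ent r + r * (hb m / ln 2)"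
    if "0 \<le> m" "m \<le> 1" "0 \<le> r" for m r
    using that by (simp add: ent_mult flip: ent_add_hb) (simp add: algebra_simps)
  have r1: "r1 = 1 - r0" using r by simp
  have lhs: "ent (m0 * r0) + ent ((1 - m0) * r0) + ent (m1 * r1) + ent ((1 - m1) * r1)
     = (hb r0 + r0 * hb m0 + r1 * hb m1) / ln 2"
    using pair[of m0 r0] pair[of m1 r1] ent_add_hb[of r0] m r unfolding r1
    by (simp add: add_divide_distrib)
  define \<delta> where "\<delta> = \<bar>m0 - m1\<bar>"
  have \<delta>: "0 \<le> \<delta>" "\<delta> \<le> 1" "k \<le> \<delta>" using m k by (auto simp: \<delta>_def)
  have "exp (hb m0) + exp (hb m1) \<le> 2 * exp (hb ((1 - \<delta>) / 2))"
  \<comment> \<open>By the symmetry of \<open>hb\<close> the larger of the two arguments is replaced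
    by its reflection; the midpoint is then \<open>(1 - \<delta>) / 2\<close>, which depends on the
    gap alone.\<close>
  proof (cases "m0 \<ge> m1")
    case True
    have "exp (hb (1 - m0)) + exp (hb m1) \<le> 2 * exp (hb ((1 - m0 + m1) / 2))"
      using exp_hb_midpoint_concave[of "1 - m0" m1] m by simp
    moreover have "1 - m0 + m1 = 1 - \<delta>" using True by (simp add: \<delta>_def)
    ultimately show ?thesis by (simp add: hb_sym)
  next
    case False
    have "exp (hb m0) + exp (hb (1 - m1)) \<le> 2 * exp (hb ((m0 + (1 - m1)) / 2))"
      using exp_hb_midpoint_concave[of m0 "1 - m1"] m by simp
    moreover have "m0 + (1 - m1) = 1 - \<delta>" using False by (simp add: \<delta>_def)
    ultimately show ?thesis by (simp add: hb_sym)
  qed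
  also have "\<dots> \<le> 2 * exp (hb ((1 - k) / 2))"
    using hb_mono[of "(1 - \<delta>) / 2" "(1 - k) / 2"] \<delta> k by simp
  finally have E: "exp (hb m0) + exp (hb m1) \<le> 2 * exp (hb ((1 - k) / 2))" .
  have "hb r0 + r0 * hb m0 + r1 * hb m1 \<le> ln (exp (hb m0) + exp (hb m1))"
    by (rule gibbs_two[OF r])
  also have "\<dots> \<le> ln (2 * exp (hb ((1 - k) / 2)))"
    using E by (subst ln_le_cancel_iff) (auto intro: add_pos_pos)
  also have "\<dots> = ln 2 + hb ((1 - k) / 2)" by (simp add: ln_mult)
  finally have "(hb r0 + r0 * hb m0 + r1 * hb m1) / ln 2 \<le> (ln 2 + hb ((1 - k) / 2)) / ln 2"
    by (intro divide_right_mono) auto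
  also have "\<dots> = 1 + hb ((1 - k) / 2) / ln 2" by (simp add: add_divide_distrib)
  \<comment> \<open>The summand 1 is the bit gained by splitting each of the weights
    \<open>(1 + k) / 2\<close> and \<open>(1 - k) / 2\<close> into equal halves.\<close>
  also have "\<dots> = 2 * ent ((1 + k) / 4) + 2 * ent ((1 - k) / 4)"
  proof -
    have k1: "k \<le> 1" using \<delta> k by simp
    have half: "ent (1 / 2) = 1 / 2" by (simp add: ent_def log_divide)
    have *: "2 * ent (z / 2) = ent z + z" if "z \<ge> 0" for z
      using ent_mult[of z "1 / 2"] that half by simp
    have "1 - (1 - k) / 2 = (1 + k) / 2" by (simp add: field_simps)
    hence "hb ((1 - k) / 2) / ln 2 = ent ((1 - k) / 2) + ent ((1 + k) / 2)"
      using ent_add_hb[of "(1 - k) / 2"] by (simp only:)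
    note e1 = this
    have e2: "2 * ent ((1 + k) / 4) = ent ((1 + k) / 2) + (1 + k) / 2"
      "2 * ent ((1 - k) / 4) = ent ((1 - k) / 2) + (1 - k) / 2"
      using *[of "(1 + k) / 2"] *[of "(1 - k) / 2"] k k1 by simp_all
    show ?thesis unfolding e1 e2 by (simp add: field_simps)
  qed
  finally show ?thesis unfolding lhs .
qed

section \<open>Spectral theorem for Hermitian matrices\<close>

definition adj :: "complex mat \<Rightarrow> complex mat" where
  "adj A = mat (dim_col A) (dim_row A) (\<lambda>(i, j). cnj (A $$ (j, i)))"

lemma adj_carrier [simp]: "A \<in> carrier_mat n m \<Longrightarrow> adj A \<in> carrier_mat m n"
  by (auto simp: adj_def)

lemma adj_index [simp]: "i < dim_col A \<Longrightarrow> j < dim_row A \<Longrightarrow> adj A $$ (i, j) = cnj (A $$ (j, i))"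
  by (simp add: adj_def)

lemma adj_dim [simp]: "dim_row (adj A) = dim_col A" "dim_col (adj A) = dim_row A"
  by (simp_all add: adj_def)

lemma adj_adj [simp]: "adj (adj A) = A"
  by (rule eq_matI) auto

lemma adj_mult:
  assumes "A \<in> carrier_mat n m" "B \<in> carrier_mat m k"
  shows "adj (A * B) = adj B * adj A"
  by (rule eq_matI) (use assms in \<open>auto simp: scalar_prod_def mult.commute\<close>)

lemma adj_one [simp]: "adj (1\<^sub>m n) = 1\<^sub>m n"
  by (rule eq_matI) auto

lemma adj_four_block_diag:
  assumes "A \<in> carrier_mat n n" "B \<in> carrier_mat m m"
  shows "adj (four_block_mat A (0\<^sub>m n m) (0\<^sub>m m n) B) = four_block_mat (adj A) (0\<^sub>m n m) (0\<^sub>m m n) (adj B)"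
  by (rule eq_matI) (use assms in auto)

lemma four_block_diag_mult:
  fixes A :: "complex mat"
  assumes "A \<in> carrier_mat n n" "B \<in> carrier_mat m m" "C \<in> carrier_mat n n" "D \<in> carrier_mat m m"
  shows "four_block_mat A (0\<^sub>m n m) (0\<^sub>m m n) B * four_block_mat C (0\<^sub>m n m) (0\<^sub>m m n) D
    = four_block_mat (A * C) (0\<^sub>m n m) (0\<^sub>m m n) (B * D)"
  by (subst mult_four_block_mat[of _ n n _ m _ m]) (use assms in auto)

text \<open>Complete \<open>v\<close> to a basis, orthogonalise by Gram-Schmidt, which keeps the
  head \<open>v\<close>, and divide every vector by its norm \<open>1 / c i\<close>. The first
  column is therefore a multiple of \<open>v\<close> only.\<close>

lemma exists_unitary_with_first_column:
  fixes v :: "complex vec"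
  assumes v: "v \<in> carrier_vec n" and v0: "v \<noteq> 0\<^sub>v n" and n: "n \<noteq> 0"
  obtains W a where "W \<in> carrier_mat n n" "adj W * W = 1\<^sub>m n" "col W 0 = a \<cdot>\<^sub>v v"
proof -
  define b where "b = basis_completion v"
  define ws where "ws = gram_schmidt n b"
  interpret cof_vec_space n "TYPE(complex)" .
  from basis_completion[OF v v0, folded b_def]
  have span_b: "span (set b) = carrier_vec n" and dist_b: "distinct b"
    and indep: "\<not> lin_dep (set b)" and b: "set b \<subseteq> carrier_vec n" and hdb: "hd b = v"
    and len_b: "length b = n" by auto
  from hdb len_b n obtain vs where bv: "b = v # vs" by (cases b, auto)
  from gram_schmidt_result[OF b dist_b indep refl, folded ws_def]
  have ws: "set ws \<subseteq> carrier_vec n" "corthogonal ws" "length ws = n"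
    by (auto simp: len_b)
  from gram_schmidt_hd[OF v, of vs, folded bv] have hdws: "hd ws = v" unfolding ws_def .
  have wsi: "ws ! i \<in> carrier_vec n" if "i < n" for i using ws that by auto
  define c where "c = (\<lambda>i. complex_of_real (1 / sqrt (\<Sum>k<n. (cmod (ws ! i $ k))\<^sup>2)))"
  define W where "W = mat n n (\<lambda>(k, i). c i * ws ! i $ k)"
  have sp: "ws ! i \<bullet>c ws ! j = (\<Sum>k<n. ws ! i $ k * cnj (ws ! j $ k))" if "i < n" "j < n" for i j
    using wsi[OF that(1)] wsi[OF that(2)] by (auto simp: scalar_prod_def atLeast0LessThan intro!: sum.cong)
  have W: "W \<in> carrier_mat n n" by (simp add: W_def)
  have inv_sqrt: "1 / sqrt x * (1 / sqrt x) * x = 1" if "x > 0" for x :: real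
    using that by simp
  have "adj W * W = 1\<^sub>m n"
  proof (rule eq_matI)
    fix i j assume "i < dim_row (1\<^sub>m n :: complex mat)" "j < dim_col (1\<^sub>m n :: complex mat)"
    hence i: "i < n" and j: "j < n" by auto
    have "(adj W * W) $$ (i, j) = (\<Sum>k<n. cnj (c i * ws ! i $ k) * (c j * ws ! j $ k))"
      using i j by (simp add: W_def scalar_prod_def atLeast0LessThan)
    also have "\<dots> = cnj (c i) * c j * (ws ! j \<bullet>c ws ! i)"
      unfolding sp[OF j i] by (simp add: sum_distrib_left mult_ac)
    finally have *: "(adj W * W) $$ (i, j) = cnj (c i) * c j * (ws ! j \<bullet>c ws ! i)" .
    show "(adj W * W) $$ (i, j) = 1\<^sub>m n $$ (i, j)"
    proof (cases "i = j")
      case False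
      thus ?thesis using * corthogonalD[OF ws(2), of j i] i j ws(3) by simp
    next
      case True
      let ?N = "\<Sum>k<n. (cmod (ws ! i $ k))\<^sup>2"
      have eq: "ws ! i \<bullet>c ws ! i = complex_of_real ?N"
        unfolding sp[OF i i] of_real_sum
        by (intro sum.cong refl) (simp only: complex_norm_square)
      have "ws ! i \<bullet>c ws ! i \<noteq> 0"
        using corthogonalD[OF ws(2), of i i] i ws(3) by simp
      hence "?N \<noteq> 0" unfolding eq by (metis of_real_0)
      moreover have "?N \<ge> 0" by (intro sum_nonneg) simp
      ultimately have N: "?N > 0" by linarith
      have "cnj (c i) * c i * complex_of_real ?N = complex_of_real (1 / sqrt ?N * (1 / sqrt ?N) * ?N)"
        unfolding c_def by (simp only: complex_cnj_complex_of_real of_real_mult)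
      also have "1 / sqrt ?N * (1 / sqrt ?N) * ?N = 1"
        using inv_sqrt[OF N] .
      finally show ?thesis using * i unfolding True[symmetric] eq by simp
    qed
  qed (simp_all add: W_def)
  moreover have "col W 0 = c 0 \<cdot>\<^sub>v v"
  proof -
    have "ws ! 0 = v" using hdws hd_conv_nth[of ws] ws(3) n by (cases ws) auto
    thus ?thesis using n v by (intro eq_vecI) (auto simp: W_def)
  qed
  ultimately show thesis using that[OF W] by blast
qed

text \<open>Deflation: conjugating by a unitary whose first column is an eigenvector clears the
  first column below the corner, Hermitian symmetry clears the first row, and the induction
  hypothesis treats the remaining block. Reality of the eigenvalues is left to
  \<open>hermitian_spectral_decomposition\<close>.\<close>

lemma hermitian_diagonalizable:
  assumes "A \<in> carrier_mat n n" "adj A = A"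
  shows "\<exists>P D. P \<in> carrier_mat n n \<and> D \<in> carrier_mat n n \<and> diagonal_mat D
    \<and> adj P * P = 1\<^sub>m n \<and> P * adj P = 1\<^sub>m n \<and> A = P * D * adj P"
  using assms
proof (induction n arbitrary: A)
  case 0
  show ?case
    by (rule exI[of _ "1\<^sub>m 0"], rule exI[of _ "1\<^sub>m 0"]) (use 0 in \<open>auto simp: diagonal_mat_def intro!: eq_matI\<close>)
next
  case (Suc m)
  let ?n = "Suc m"
  have sq: "X * Y \<in> carrier_mat ?n ?n" if "X \<in> carrier_mat ?n ?n" "Y \<in> carrier_mat ?n ?n"
    for X Y :: "complex mat" using that by (rule mult_carrier_mat)
  note assoc = assoc_mult_mat[of _ ?n ?n _ ?n _ ?n] sq
  note A = Suc.prems(1) and herm = Suc.prems(2)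
  have "\<not> constant (poly (char_poly A))"
    using degree_monic_char_poly[OF A] by (auto simp: constant_degree)
  then obtain e where "poly (char_poly A) e = 0"
    using fundamental_theorem_of_algebra by blast
  hence "eigenvalue A e" using eigenvalue_root_char_poly[OF A] by simp
  then obtain v where "eigenvector A v e" unfolding eigenvalue_def by blast
  hence v: "v \<in> carrier_vec ?n" "v \<noteq> 0\<^sub>v ?n" and ev: "A *\<^sub>v v = e \<cdot>\<^sub>v v"
    using A unfolding eigenvector_def by auto
  obtain W a where W: "W \<in> carrier_mat ?n ?n" and WW: "adj W * W = 1\<^sub>m ?n" and colW: "col W 0 = a \<cdot>\<^sub>v v"
    using exists_unitary_with_first_column[OF v] by auto
  have aW: "adj W \<in> carrier_mat ?n ?n" using W by simp
  have WW': "W * adj W = 1\<^sub>m ?n" by (rule mat_mult_left_right_inverse[OF aW W WW])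
  define A' where "A' = adj W * A * W"
  have A': "A' \<in> carrier_mat ?n ?n" using W A aW unfolding A'_def by auto
  have herm': "adj A' = A'"
  proof -
    have "adj A' = adj W * adj (adj W * A)" unfolding A'_def
      using W A aW by (subst adj_mult[of _ ?n ?n _ ?n]) auto
    also have "adj (adj W * A) = A * W"
      using W A aW herm by (subst adj_mult[of _ ?n ?n _ ?n]) auto
    also have "adj W * (A * W) = A'" unfolding A'_def
      using W A aW by (simp add: assoc)
    finally show ?thesis .
  qed
  have col0: "A' $$ (i, 0) = (if i = 0 then e else 0)" if i: "i < ?n" for i
  proof -
    have "A' = adj W * (A * W)" unfolding A'_def by (rule assoc_mult_mat[OF aW A W])
    hence "A' $$ (i, 0) = row (adj W) i \<bullet> col (A * W) 0" using i aW A W by simp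
    also have "col (A * W) 0 = A *\<^sub>v col W 0" by (rule col_mult2[OF A W]) simp
    also have "\<dots> = e \<cdot>\<^sub>v col W 0"
      unfolding colW using A v by (simp add: mult_mat_vec ev smult_smult_assoc mult.commute)
    also have "row (adj W) i \<bullet> (e \<cdot>\<^sub>v col W 0) = e * (row (adj W) i \<bullet> col W 0)"
      by (rule scalar_prod_smult_distrib[of _ ?n]) (use aW W i in \<open>auto intro: col_carrier_vec row_carrier_vec\<close>)
    also have "row (adj W) i \<bullet> col W 0 = (adj W * W) $$ (i, 0)" using aW W i by simp
    finally show ?thesis unfolding WW using i by simp
  qed
  have row0: "A' $$ (0, i) = (if i = 0 then cnj e else 0)" if i: "i < ?n" for i
  proof -
    have "A' $$ (0, i) = cnj (A' $$ (i, 0))"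
      using A' i by (subst herm'[symmetric]) simp
    thus ?thesis using col0[OF i] by simp
  qed
  define B where "B = mat m m (\<lambda>(i, j). A' $$ (Suc i, Suc j))"
  have B: "B \<in> carrier_mat m m" by (simp add: B_def)
  have "adj B = B"
  proof (rule eq_matI)
    fix i j assume "i < dim_row B" "j < dim_col B"
    hence ij: "i < m" "j < m" by (auto simp: B_def)
    have "cnj (A' $$ (Suc j, Suc i)) = A' $$ (Suc i, Suc j)"
      using A' ij by (subst (2) herm'[symmetric]) simp
    thus "adj B $$ (i, j) = B $$ (i, j)" using ij by (simp add: B_def)
  qed (simp_all add: B_def)
  from Suc.IH[OF B this] obtain P D where P: "P \<in> carrier_mat m m" and D: "D \<in> carrier_mat m m"
    and diag: "diagonal_mat D" and PP: "adj P * P = 1\<^sub>m m" "P * adj P = 1\<^sub>m m" and BP: "B = P * D * adj P"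
    by blast
  let ?blk = "\<lambda>X Y. four_block_mat X (0\<^sub>m 1 m) (0\<^sub>m m 1) Y"
  let ?e = "mat 1 1 (\<lambda>_. e)"
  have A'blk: "A' = ?blk ?e B"
  proof (rule eq_matI)
    fix i j assume "i < dim_row (?blk ?e B)" "j < dim_col (?blk ?e B)"
    hence "i < ?n" "j < ?n" using B by auto
    thus "A' $$ (i, j) = ?blk ?e B $$ (i, j)"
      using col0[of i] row0[of j] B by (cases i; cases j) (auto simp: B_def)
  qed (use A' B in auto)
  define R where "R = ?blk (1\<^sub>m 1) P"
  define E where "E = ?blk ?e D"
  have R: "R \<in> carrier_mat ?n ?n" and E: "E \<in> carrier_mat ?n ?n"
    using P D by (auto simp: R_def E_def)
  have aR: "adj R = ?blk (1\<^sub>m 1) (adj P)"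
    unfolding R_def using P by (simp add: adj_four_block_diag)
  have blk1: "?blk (1\<^sub>m 1) (1\<^sub>m m) = 1\<^sub>m ?n"
    by (rule eq_matI) auto
  have RR: "adj R * R = 1\<^sub>m ?n" "R * adj R = 1\<^sub>m ?n"
    unfolding aR unfolding R_def using P PP blk1 by (simp_all add: four_block_diag_mult)
  have RER: "R * E * adj R = A'"
    unfolding aR A'blk BP unfolding R_def E_def using P D
    by (simp add: four_block_diag_mult)
  have diagE: "diagonal_mat E"
    using diag D unfolding diagonal_mat_def E_def by (auto simp: less_Suc_eq_0_disj) blast
  define Q where "Q = W * R"
  have Q: "Q \<in> carrier_mat ?n ?n" using W R by (simp add: Q_def)
  have aQ: "adj Q = adj R * adj W" unfolding Q_def by (rule adj_mult[OF W R])
  have aRc: "adj R \<in> carrier_mat ?n ?n" using R by simp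
  have QQ: "adj Q * Q = 1\<^sub>m ?n"
  proof -
    have "adj Q * Q = adj R * (adj W * W) * R"
      unfolding aQ unfolding Q_def using W R aW aRc by (simp add: assoc)
    thus ?thesis using WW RR R aRc by simp
  qed
  have QQ': "Q * adj Q = 1\<^sub>m ?n" by (rule mat_mult_left_right_inverse[OF _ Q QQ]) (use Q in simp)
  have "A = Q * E * adj Q"
  proof -
    have "Q * E * adj Q = W * (R * E * adj R) * adj W"
      unfolding aQ unfolding Q_def using W R aW aRc E by (simp add: assoc)
    also have "\<dots> = (W * adj W) * A * (W * adj W)"
      unfolding RER A'_def using W A aW by (simp add: assoc)
    also have "\<dots> = A" unfolding WW' using A by simp
    finally show ?thesis by simp
  qed
  thus ?case using Q E diagE QQ QQ' by blast
qed

section \<open>Bounds for the von Neumann entropy\<close>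

text \<open>Similar matrices share the characteristic polynomial, and that of a diagonal matrix has
  the diagonal, with multiplicity, as its roots.\<close>

lemma vn_entropy_unitary_diag:
  assumes P: "P \<in> carrier_mat n n" and D: "D \<in> carrier_mat n n" and diag: "diagonal_mat D"
    and PP: "adj P * P = 1\<^sub>m n" "P * adj P = 1\<^sub>m n" and A: "A = P * D * adj P"
  shows "vn_entropy A = (\<Sum>j<n. ent (Re (D $$ (j, j))))"
proof -
  have "similar_mat A D" unfolding similar_mat_def similar_mat_wit_def
    by (intro exI[of _ P] exI[of _ "adj P"]) (use assms in \<open>auto simp: Let_def\<close>)
  hence "char_poly A = char_poly D" by (rule char_poly_similar)
  also have "\<dots> = (\<Prod>a\<leftarrow>diag_mat D. [:- a, 1:])"
    by (rule char_poly_upper_triangular[OF D]) (use diag D in \<open>auto simp: diagonal_mat_def\<close>)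
  finally have cp: "char_poly A = (\<Prod>a\<leftarrow>diag_mat D. [:- a, 1:])" .
  have "proots (\<Prod>a\<leftarrow>as. [:- a, 1:]) = mset as" for as :: "complex list"
  proof (induction as)
    case (Cons a as)
    have "(\<Prod>a\<leftarrow>as. [:- a, 1:]) \<noteq> 0" by (simp add: prod_list_zero_iff image_iff)
    thus ?case using Cons by (simp add: proots_mult del: mult_pCons_left)
  qed simp
  hence "proots (char_poly A) = mset (diag_mat D)" by (simp add: cp)
  hence "vn_entropy A = sum_list (map (\<lambda>e. ent (Re e)) (diag_mat D))"
    unfolding vn_entropy_def ent_def by (simp flip: mset_map sum_mset_sum_list)
  also have "\<dots> = (\<Sum>j<n. ent (Re (D $$ (j, j))))"
    using D unfolding diag_mat_def
    by (simp add: o_def atLeast0LessThan flip: sum.distinct_set_conv_list[of "[0..<n]"] )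
  finally show ?thesis .
qed

text \<open>Read left to right, this evaluates a sesquilinear form on a sum of rank-one matrices;
  right to left, it recovers the form. It is the bridge between Gram and spectral representations of
  one matrix.\<close>

lemma sum_sandwich:
  fixes c :: "'j \<Rightarrow> complex"
  shows "(\<Sum>i\<in>I. \<Sum>k\<in>K. a i * (\<Sum>j\<in>J. c j * f j i * g j k) * b k)
    = (\<Sum>j\<in>J. c j * (\<Sum>i\<in>I. f j i * a i) * (\<Sum>k\<in>K. b k * g j k))"
proof -
  have "(\<Sum>i\<in>I. \<Sum>k\<in>K. a i * (\<Sum>j\<in>J. c j * f j i * g j k) * b k)
      = (\<Sum>i\<in>I. \<Sum>k\<in>K. \<Sum>j\<in>J. c j * (f j i * a i) * (b k * g j k))"
    by (intro sum.cong refl) (simp add: sum_distrib_left sum_distrib_right mult_ac)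
  also have "\<dots> = (\<Sum>i\<in>I. \<Sum>j\<in>J. \<Sum>k\<in>K. c j * (f j i * a i) * (b k * g j k))"
    by (intro sum.cong refl sum.swap)
  also have "\<dots> = (\<Sum>j\<in>J. \<Sum>i\<in>I. \<Sum>k\<in>K. c j * (f j i * a i) * (b k * g j k))"
    by (rule sum.swap)
  also have "\<dots> = (\<Sum>j\<in>J. c j * (\<Sum>i\<in>I. f j i * a i) * (\<Sum>k\<in>K. b k * g j k))"
    unfolding mult.assoc sum_product by (simp only: sum_distrib_left mult.assoc)
  finally show ?thesis .
qed

text \<open>The first argument of \<open>u\<close> numbers the vectors, the second their components.
  Orthonormality and completeness are both recorded, so each can be quoted without a matrix
  inverse.\<close>

definition onb :: "nat \<Rightarrow> (nat \<Rightarrow> nat \<Rightarrow> complex) \<Rightarrow> bool" where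
  "onb n u \<longleftrightarrow> (\<forall>j<n. \<forall>l<n. (\<Sum>i<n. u j i * cnj (u l i)) = (if j = l then 1 else 0))
     \<and> (\<forall>i<n. \<forall>k<n. (\<Sum>j<n. u j i * cnj (u j k)) = (if i = k then 1 else 0))"

lemma hermitian_spectral_decomposition:
  assumes A: "A \<in> carrier_mat n n" and herm: "\<And>i j. i < n \<Longrightarrow> j < n \<Longrightarrow> A $$ (i, j) = cnj (A $$ (j, i))"
  obtains u :: "nat \<Rightarrow> nat \<Rightarrow> complex" and lam :: "nat \<Rightarrow> real" where "onb n u"
    "\<forall>i<n. \<forall>k<n. A $$ (i, k) = (\<Sum>j<n. complex_of_real (lam j) * u j i * cnj (u j k))"
    "vn_entropy A = (\<Sum>j<n. ent (lam j))"
proof -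
  have "adj A = A" by (rule eq_matI) (use A herm[symmetric] in auto)
  from hermitian_diagonalizable[OF A this]
  obtain P D where P: "P \<in> carrier_mat n n" and D: "D \<in> carrier_mat n n" and diag: "diagonal_mat D"
    and PP: "adj P * P = 1\<^sub>m n" "P * adj P = 1\<^sub>m n" and AP: "A = P * D * adj P" by blast
  define u where "u = (\<lambda>j i. P $$ (i, j))"
  define d where "d = (\<lambda>j. D $$ (j, j))"
  have aP: "adj P \<in> carrier_mat n n" using P by simp
  have ortho: "(\<Sum>i<n. u j i * cnj (u l i)) = (if j = l then 1 else 0)" if "j < n" "l < n" for j l
  proof -
    have "(adj P * P) $$ (l, j) = (\<Sum>i<n. u j i * cnj (u l i))"
      using P that by (simp add: scalar_prod_def u_def atLeast0LessThan mult.commute)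
    thus ?thesis using PP that by auto
  qed
  have compl: "(\<Sum>j<n. u j i * cnj (u j k)) = (if i = k then 1 else 0)" if "i < n" "k < n" for i k
  proof -
    have "(P * adj P) $$ (i, k) = (\<Sum>j<n. u j i * cnj (u j k))"
      using P that by (simp add: scalar_prod_def u_def atLeast0LessThan)
    thus ?thesis using PP that by auto
  qed
  have PD: "(P * D) $$ (i, j) = P $$ (i, j) * d j" if "i < n" "j < n" for i j
  proof -
    have "(P * D) $$ (i, j) = (\<Sum>k<n. P $$ (i, k) * D $$ (k, j))"
      using P D that by (simp add: scalar_prod_def atLeast0LessThan)
    also have "\<dots> = (\<Sum>k<n. if k = j then P $$ (i, j) * d j else 0)"
      by (intro sum.cong) (use diag D that in \<open>auto simp: diagonal_mat_def d_def\<close>)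
    finally show ?thesis using that by simp
  qed
  have dec: "A $$ (i, k) = (\<Sum>j<n. d j * u j i * cnj (u j k))" if "i < n" "k < n" for i k
  proof -
    have "A $$ (i, k) = (\<Sum>j<n. (P * D) $$ (i, j) * adj P $$ (j, k))"
      unfolding AP using P D aP that by (subst index_mult_mat) (auto simp: scalar_prod_def atLeast0LessThan)
    also have "\<dots> = (\<Sum>j<n. d j * u j i * cnj (u j k))"
      by (intro sum.cong refl) (use P that in \<open>simp add: PD u_def del: index_mult_mat\<close>)
    finally show ?thesis .
  qed
  \<comment> \<open>The eigenvalue equals the quadratic form of \<open>A\<close> at its own
    eigenvector, and Hermitian symmetry makes that form its own conjugate.\<close>
  have real: "d l = complex_of_real (Re (d l))" if l: "l < n" for l
  proof -
    have "d l = (\<Sum>j<n. d j * (\<Sum>i<n. u j i * cnj (u l i)) * (\<Sum>k<n. u l k * cnj (u j k)))"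
    proof -
      have "d j * (\<Sum>i<n. u j i * cnj (u l i)) * (\<Sum>k<n. u l k * cnj (u j k)) = (if j = l then d l else 0)"
        if "j < n" for j using l that by (simp add: ortho)
      thus ?thesis using l by simp
    qed
    also have "\<dots> = (\<Sum>i<n. \<Sum>k<n. cnj (u l i) * A $$ (i, k) * u l k)"
      by (simp add: dec sum_sandwich)
    finally have q: "d l = (\<Sum>i<n. \<Sum>k<n. cnj (u l i) * A $$ (i, k) * u l k)" .
    have "cnj (d l) = (\<Sum>i<n. \<Sum>k<n. u l i * A $$ (k, i) * cnj (u l k))"
      unfolding q by (auto intro!: sum.cong simp: herm[symmetric])
    also have "\<dots> = d l" unfolding q by (subst sum.swap) (simp add: mult_ac)
    finally show ?thesis by (metis Reals_cnj_iff of_real_Re)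
  qed
  show thesis
  proof (rule that[of u "\<lambda>j. Re (d j)"])
    show "onb n u" unfolding onb_def using ortho compl by blast
    show "\<forall>i<n. \<forall>k<n. A $$ (i, k) = (\<Sum>j<n. complex_of_real (Re (d j)) * u j i * cnj (u j k))"
      by (simp add: dec real[symmetric])
    show "vn_entropy A = (\<Sum>j<n. ent (Re (d j)))"
      unfolding d_def by (rule vn_entropy_unitary_diag[OF P D diag PP AP])
  qed
qed

lemma onb_parseval:
  assumes "onb n u"
  shows "(\<Sum>j<n. (cmod (\<Sum>i<n. x i * cnj (u j i)))\<^sup>2) = (\<Sum>i<n. (cmod (x i))\<^sup>2)"
proof -
  have "complex_of_real (\<Sum>j<n. (cmod (\<Sum>i<n. x i * cnj (u j i)))\<^sup>2)
      = (\<Sum>j<n. 1 * (\<Sum>k<n. u j k * cnj (x k)) * (\<Sum>i<n. x i * cnj (u j i)))"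
    unfolding of_real_sum complex_norm_square by (simp add: mult_ac)
  also have "\<dots> = (\<Sum>k<n. \<Sum>i<n. cnj (x k) * (\<Sum>j<n. 1 * u j k * cnj (u j i)) * x i)"
    by (rule sum_sandwich[symmetric])
  also have "\<dots> = (\<Sum>k<n. \<Sum>i<n. if i = k then cnj (x k) * x k else 0)"
    using assms by (intro sum.cong refl) (auto simp: onb_def)
  also have "\<dots> = complex_of_real (\<Sum>i<n. (cmod (x i))\<^sup>2)"
    unfolding of_real_sum complex_norm_square by (simp add: mult.commute)
  finally show ?thesis by (simp only: of_real_eq_iff)
qed

text \<open>Both sides are the quadratic form at \<open>y\<close> of a single matrix, known once as
  a Gram matrix and once through its spectral sum.\<close>

lemma gram_quadratic_form:
  assumes "\<And>i k. i < n \<Longrightarrow> k < n \<Longrightarrow>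
    (\<Sum>x\<in>X. T x i * cnj (T x k)) = (\<Sum>j<n. complex_of_real (lam j) * u j i * cnj (u j k))"
  shows "(\<Sum>x\<in>X. (cmod (\<Sum>i<n. T x i * cnj (y i)))\<^sup>2)
      = (\<Sum>j<n. lam j * (cmod (\<Sum>i<n. u j i * cnj (y i)))\<^sup>2)"
proof -
  have "complex_of_real (\<Sum>x\<in>X. (cmod (\<Sum>i<n. T x i * cnj (y i)))\<^sup>2)
      = (\<Sum>x\<in>X. 1 * (\<Sum>i<n. T x i * cnj (y i)) * (\<Sum>k<n. y k * cnj (T x k)))"
    unfolding of_real_sum complex_norm_square by (simp add: mult_ac)
  also have "\<dots> = (\<Sum>i<n. \<Sum>k<n. cnj (y i) * (\<Sum>x\<in>X. 1 * T x i * cnj (T x k)) * y k)"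
    by (rule sum_sandwich[symmetric])
  also have "\<dots> = (\<Sum>i<n. \<Sum>k<n. cnj (y i) * (\<Sum>j<n. complex_of_real (lam j) * u j i * cnj (u j k)) * y k)"
    by (intro sum.cong refl) (simp add: assms)
  also have "\<dots> = (\<Sum>j<n. complex_of_real (lam j) * (\<Sum>i<n. u j i * cnj (y i)) * (\<Sum>k<n. y k * cnj (u j k)))"
    by (rule sum_sandwich)
  also have "\<dots> = complex_of_real (\<Sum>j<n. lam j * (cmod (\<Sum>i<n. u j i * cnj (y i)))\<^sup>2)"
    unfolding of_real_sum of_real_mult complex_norm_square by (simp add: mult_ac)
  finally show ?thesis by (simp only: of_real_eq_iff)
qed

lemma gram_eigenvalue:
  assumes u: "onb n u"
    and gram: "\<And>i k. i < n \<Longrightarrow> k < n \<Longrightarrow>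
      (\<Sum>x\<in>X. T x i * cnj (T x k)) = (\<Sum>j<n. complex_of_real (lam j) * u j i * cnj (u j k))"
    and j: "j < n"
  shows "lam j = (\<Sum>x\<in>X. (cmod (\<Sum>i<n. T x i * cnj (u j i)))\<^sup>2)"
proof -
  have "(\<Sum>x\<in>X. (cmod (\<Sum>i<n. T x i * cnj (u j i)))\<^sup>2)
      = (\<Sum>l<n. lam l * (cmod (\<Sum>i<n. u l i * cnj (u j i)))\<^sup>2)"
    by (rule gram_quadratic_form[OF gram])
  also have "\<dots> = (\<Sum>l<n. if l = j then lam j else 0)"
    using u j by (intro sum.cong refl) (auto simp: onb_def)
  finally show ?thesis using j by simp
qed

text \<open>Measuring in an orthonormal basis does not lower entropy: the diagonal in
  \<open>v\<close> is the image of the spectrum under the doubly stochastic matrix \<open>p\<close>.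
  Row sums allow Jensen, column sums restore the spectral entropy.\<close>

lemma vn_entropy_le_diagonal:
  assumes A: "A \<in> carrier_mat n n"
    and gram: "\<And>i k. i < n \<Longrightarrow> k < n \<Longrightarrow> A $$ (i, k) = (\<Sum>x\<in>X. T x i * cnj (T x k))"
    and v: "onb n v"
  shows "vn_entropy A \<le> (\<Sum>l<n. ent (\<Sum>x\<in>X. (cmod (\<Sum>i<n. T x i * cnj (v l i)))\<^sup>2))"
proof -
  have herm: "A $$ (i, j) = cnj (A $$ (j, i))" if "i < n" "j < n" for i j
    using that by (simp add: gram mult.commute)
  obtain u lam where u: "onb n u"
    and dec: "\<forall>i<n. \<forall>k<n. A $$ (i, k) = (\<Sum>j<n. complex_of_real (lam j) * u j i * cnj (u j k))"
    and S: "vn_entropy A = (\<Sum>j<n. ent (lam j))"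
    by (rule hermitian_spectral_decomposition[OF A herm])
  define p where "p = (\<lambda>l j. (cmod (\<Sum>i<n. u j i * cnj (v l i)))\<^sup>2)"
  have gram': "(\<Sum>x\<in>X. T x i * cnj (T x k)) = (\<Sum>j<n. complex_of_real (lam j) * u j i * cnj (u j k))"
    if "i < n" "k < n" for i k using that gram dec by metis
  note form = gram_quadratic_form[OF gram']
  have lam0: "lam j \<ge> 0" if "j < n" for j
    using gram_eigenvalue[OF u gram' that] by (simp add: sum_nonneg)
  have p0: "p l j \<ge> 0" for l j by (simp add: p_def)
  have row: "(\<Sum>j<n. p l j) = 1" if l: "l < n" for l
  proof -
    have "p l j = (cmod (\<Sum>i<n. v l i * cnj (u j i)))\<^sup>2" for j
    proof -
      have "(\<Sum>i<n. u j i * cnj (v l i)) = cnj (\<Sum>i<n. v l i * cnj (u j i))" by (simp add: mult.commute)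
      thus ?thesis unfolding p_def by (simp only: complex_mod_cnj)
    qed
    hence "(\<Sum>j<n. p l j) = (\<Sum>i<n. (cmod (v l i))\<^sup>2)" using onb_parseval[OF u, of "v l"] by simp
    also have "complex_of_real \<dots> = (\<Sum>i<n. v l i * cnj (v l i))"
      unfolding of_real_sum complex_norm_square ..
    also have "\<dots> = complex_of_real 1" using v l by (auto simp: onb_def)
    finally show ?thesis by (simp only: of_real_eq_iff)
  qed
  have col: "(\<Sum>l<n. p l j) = 1" if j: "j < n" for j
  proof -
    have "(\<Sum>l<n. p l j) = (\<Sum>i<n. (cmod (u j i))\<^sup>2)" unfolding p_def by (rule onb_parseval[OF v])
    also have "complex_of_real \<dots> = (\<Sum>i<n. u j i * cnj (u j i))"
      unfolding of_real_sum complex_norm_square ..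
    also have "\<dots> = complex_of_real 1" using u j by (auto simp: onb_def)
    finally show ?thesis by (simp only: of_real_eq_iff)
  qed
  have "vn_entropy A = (\<Sum>j<n. (\<Sum>l<n. p l j) * ent (lam j))" unfolding S by (simp add: col)
  also have "\<dots> = (\<Sum>l<n. \<Sum>j<n. p l j * ent (lam j))"
    by (simp add: sum_distrib_right) (rule sum.swap)
  also have "\<dots> \<le> (\<Sum>l<n. ent (\<Sum>j<n. p l j * lam j))"
    by (intro sum_mono ent_jensen) (auto simp: lam0 row p0)
  also have "\<dots> = (\<Sum>l<n. ent (\<Sum>x\<in>X. (cmod (\<Sum>i<n. T x i * cnj (v l i)))\<^sup>2))"
    by (simp add: form p_def mult.commute)
  finally show ?thesis .
qed

text \<open>The vectors \<open>a m\<close> are those of an ensemble for a density matrix, written in its eigenbasis.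
  The weights \<open>p m j\<close> below express the ensemble weights through the eigenvalues; their row
  sums are at most 1 because the density matrix dominates each of its rank-one summands.\<close>

lemma ensemble_entropy_ge:
  fixes lam :: "nat \<Rightarrow> real" and a :: "'m \<Rightarrow> nat \<Rightarrow> complex"
  assumes fin: "finite M"
    and orth: "\<And>j l. j < n \<Longrightarrow> l < n \<Longrightarrow> (\<Sum>m\<in>M. a m j * cnj (a m l)) = (if j = l then lam j else 0)"
  shows "(\<Sum>j<n. ent (lam j)) \<le> (\<Sum>m\<in>M. ent (\<Sum>j<n. (cmod (a m j))\<^sup>2))"
proof -
  have lam: "lam j = (\<Sum>m\<in>M. (cmod (a m j))\<^sup>2)" if "j < n" for j
  proof -
    have "complex_of_real (\<Sum>m\<in>M. (cmod (a m j))\<^sup>2) = complex_of_real (lam j)"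
      unfolding of_real_sum complex_norm_square using orth[OF that that] by simp
    thus ?thesis by (simp only: of_real_eq_iff)
  qed
  have lam0: "lam j \<ge> 0" if "j < n" for j unfolding lam[OF that] by (intro sum_nonneg) simp
  have a0: "a m j = 0" if "j < n" "m \<in> M" "lam j = 0" for m j
    using that fin unfolding lam[OF that(1)] by (subst (asm) sum_nonneg_eq_0_iff) auto
  \<comment> \<open>At \<open>lam j = 0\<close> the quotient is 0 by convention, which is consistent
    because \<open>a m j\<close> vanishes there by \<open>a0\<close>.\<close>
  define p where "p = (\<lambda>m j. (cmod (a m j))\<^sup>2 / lam j)"
  have p0: "p m j \<ge> 0" if "j < n" for m j using lam0[OF that] by (simp add: p_def)
  have plam: "p m j * lam j = (cmod (a m j))\<^sup>2" if "j < n" "m \<in> M" for m j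
    using a0[OF that] by (auto simp: p_def)
  have psum: "(\<Sum>m\<in>M. p m j) * ent (lam j) = ent (lam j)" if "j < n" for j
    by (cases "lam j = 0") (auto simp: p_def lam[OF that] simp flip: sum_divide_distrib)
  have row: "(\<Sum>j<n. p m j) \<le> 1" if m: "m \<in> M" for m
  proof -
    define t where "t = (\<Sum>j<n. p m j)"
    \<comment> \<open>The generalised inverse of the density matrix applied to the ensemble vector
      \<open>a m\<close>. The density matrix has quadratic form \<open>t\<close> at
      \<open>z\<close>, while the summand of \<open>m\<close> alone is already \<open>t^2\<close>;
      hence \<open>t^2 \<le> t\<close>.\<close>
    define z where "z = (\<lambda>j. a m j / lam j)"
    have t0: "t \<ge> 0" unfolding t_def by (intro sum_nonneg) (simp add: p0)
    have az: "cnj (a m j) * z j = complex_of_real (p m j)" for j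
      unfolding z_def p_def of_real_divide complex_norm_square by simp
    have "t\<^sup>2 = (cmod (\<Sum>j<n. cnj (a m j) * z j))\<^sup>2"
      unfolding az t_def by (simp flip: of_real_sum)
    also have "\<dots> \<le> (\<Sum>m'\<in>M. (cmod (\<Sum>j<n. cnj (a m' j) * z j))\<^sup>2)"
      using fin m by (intro member_le_sum) auto
    also have "\<dots> = t"
    proof -
      have "complex_of_real (\<Sum>m'\<in>M. (cmod (\<Sum>j<n. cnj (a m' j) * z j))\<^sup>2)
          = (\<Sum>m'\<in>M. 1 * (\<Sum>l<n. a m' l * cnj (z l)) * (\<Sum>j<n. z j * cnj (a m' j)))"
        unfolding of_real_sum complex_norm_square by (simp add: mult_ac)
      also have "\<dots> = (\<Sum>l<n. \<Sum>j<n. cnj (z l) * (\<Sum>m'\<in>M. 1 * a m' l * cnj (a m' j)) * z j)"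
        by (rule sum_sandwich[symmetric])
      also have "\<dots> = (\<Sum>l<n. \<Sum>j<n. if j = l then cnj (z l) * lam l * z l else 0)"
        by (intro sum.cong refl) (auto simp: orth)
      also have "\<dots> = (\<Sum>l<n. complex_of_real (p m l))"
        by (auto intro!: sum.cong simp: az[symmetric] z_def)
      finally have "complex_of_real (\<Sum>m'\<in>M. (cmod (\<Sum>j<n. cnj (a m' j) * z j))\<^sup>2) = complex_of_real t"
        by (simp add: t_def)
      thus ?thesis by (simp only: of_real_eq_iff)
    qed
    finally have "t * t \<le> 1 * t" by (simp add: power2_eq_square)
    thus ?thesis using t0 unfolding t_def[symmetric] by (cases "t = 0") (auto simp: mult_le_cancel_right)
  qed
  have "(\<Sum>j<n. ent (lam j)) = (\<Sum>j<n. (\<Sum>m\<in>M. p m j) * ent (lam j))" by (simp add: psum)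
  also have "\<dots> = (\<Sum>m\<in>M. \<Sum>j<n. p m j * ent (lam j))"
    by (simp add: sum_distrib_right) (rule sum.swap)
  also have "\<dots> \<le> (\<Sum>m\<in>M. ent (\<Sum>j<n. p m j * lam j))"
    by (intro sum_mono ent_jensen) (auto simp: lam0 row p0)
  also have "\<dots> = (\<Sum>m\<in>M. ent (\<Sum>j<n. (cmod (a m j))\<^sup>2))" by (simp add: plam)
  finally show ?thesis .
qed

text \<open>The index involution \<open>\<tau>\<close> acts as a unitary permutation; averaging over it is a pinching, which
  cannot decrease the entropy.\<close>

lemma vn_entropy_le_pinched_ensemble:
  assumes A: "A \<in> carrier_mat n n"
    and gram: "\<And>i k. i < n \<Longrightarrow> k < n \<Longrightarrow> A $$ (i, k) = (\<Sum>x\<in>X. T x i * cnj (T x k))"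
    and flip: "\<And>i. i < n \<Longrightarrow> \<tau> i < n \<and> \<tau> (\<tau> i) = i" and fin: "finite M"
    and ens: "\<And>i k. i < n \<Longrightarrow> k < n \<Longrightarrow>
       (A $$ (i, k) + A $$ (\<tau> i, \<tau> k)) / 2 = (\<Sum>m\<in>M. V m i * cnj (V m k))"
  shows "vn_entropy A \<le> (\<Sum>m\<in>M. ent (\<Sum>i<n. (cmod (V m i))\<^sup>2))"
proof -
  have bij: "bij_betw \<tau> {..<n} {..<n}"
    by (rule bij_betwI[of _ _ _ \<tau>]) (use flip in auto)
  define D where "D = mat n n (\<lambda>(i, k). \<Sum>m\<in>M. V m i * cnj (V m k))"
  have D: "D \<in> carrier_mat n n" by (simp add: D_def)
  have herm: "D $$ (i, j) = cnj (D $$ (j, i))" if "i < n" "j < n" for i j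
    using that by (simp add: D_def mult.commute)
  obtain u lam where u: "onb n u"
    and dec: "\<forall>i<n. \<forall>k<n. D $$ (i, k) = (\<Sum>j<n. complex_of_real (lam j) * u j i * cnj (u j k))"
    and "vn_entropy D = (\<Sum>j<n. ent (lam j))"
    by (rule hermitian_spectral_decomposition[OF D herm])
  define a where "a = (\<lambda>m j. \<Sum>i<n. V m i * cnj (u j i))"
  have orth: "(\<Sum>m\<in>M. a m j * cnj (a m l)) = complex_of_real (if j = l then lam j else 0)" if "j < n" "l < n" for j l
  proof -
    have "(\<Sum>m\<in>M. a m j * cnj (a m l)) = (\<Sum>m\<in>M. 1 * (\<Sum>i<n. V m i * cnj (u j i)) * (\<Sum>k<n. u l k * cnj (V m k)))"
      unfolding a_def by (simp add: mult_ac)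
    also have "\<dots> = (\<Sum>i<n. \<Sum>k<n. cnj (u j i) * (\<Sum>m\<in>M. 1 * V m i * cnj (V m k)) * u l k)"
      by (rule sum_sandwich[symmetric])
    also have "\<dots> = (\<Sum>i<n. \<Sum>k<n. cnj (u j i) * (\<Sum>h<n. complex_of_real (lam h) * u h i * cnj (u h k)) * u l k)"
      using dec by (intro sum.cong refl) (simp add: D_def)
    also have "\<dots> = (\<Sum>h<n. complex_of_real (lam h) * (\<Sum>i<n. u h i * cnj (u j i)) * (\<Sum>k<n. u l k * cnj (u h k)))"
      by (rule sum_sandwich)
    also have "\<dots> = (\<Sum>h<n. if h = j then complex_of_real (if j = l then lam j else 0) else 0)"
      using u that by (intro sum.cong refl) (auto simp: onb_def)
    finally show ?thesis using that by simp
  qed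
  \<comment> \<open>Diagonals of \<open>A\<close> in the eigenbasis \<open>u\<close> of the averaged
    matrix \<open>D\<close> and in its image under \<open>\<tau>\<close>. Each has entropy at least
    that of \<open>A\<close>, and their mean is the spectrum of \<open>D\<close>, so scalar
    concavity replaces concavity of the matrix entropy.\<close>
  define x where "x = (\<lambda>j. \<Sum>t\<in>X. (cmod (\<Sum>i<n. T t i * cnj (u j i)))\<^sup>2)"
  define y where "y = (\<lambda>j. \<Sum>t\<in>X. (cmod (\<Sum>i<n. T t i * cnj (u j (\<tau> i))))\<^sup>2)"
  have x0: "x j \<ge> 0" and y0: "y j \<ge> 0" for j by (auto simp: x_def y_def intro!: sum_nonneg)
  have Sx: "vn_entropy A \<le> (\<Sum>j<n. ent (x j))"
    unfolding x_def by (rule vn_entropy_le_diagonal[OF A gram u])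
  have "onb n (\<lambda>j i. u j (\<tau> i))"
  proof -
    have "(\<Sum>i<n. u j (\<tau> i) * cnj (u l (\<tau> i))) = (\<Sum>i<n. u j i * cnj (u l i))" for j l
      by (rule sum.reindex_bij_betw[OF bij, of "\<lambda>i. u j i * cnj (u l i)"])
    moreover have "\<tau> i = \<tau> k \<longleftrightarrow> i = k" if "i < n" "k < n" for i k using flip that by metis
    ultimately show ?thesis using u flip unfolding onb_def by auto
  qed
  hence Sy: "vn_entropy A \<le> (\<Sum>j<n. ent (y j))"
    unfolding y_def using vn_entropy_le_diagonal[OF A gram] by blast
  have mid: "(x j + y j) / 2 = lam j" if j: "j < n" for j
  proof -
    have form: "complex_of_real (\<Sum>t\<in>X. (cmod (\<Sum>i<n. T t i * cnj (w i)))\<^sup>2)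
        = (\<Sum>i<n. \<Sum>k<n. cnj (w i) * A $$ (i, k) * w k)" for w
    proof -
      have "complex_of_real (\<Sum>t\<in>X. (cmod (\<Sum>i<n. T t i * cnj (w i)))\<^sup>2)
          = (\<Sum>t\<in>X. 1 * (\<Sum>i<n. T t i * cnj (w i)) * (\<Sum>k<n. w k * cnj (T t k)))"
        unfolding of_real_sum complex_norm_square by (simp add: mult_ac)
      also have "\<dots> = (\<Sum>i<n. \<Sum>k<n. cnj (w i) * (\<Sum>t\<in>X. 1 * T t i * cnj (T t k)) * w k)"
        by (rule sum_sandwich[symmetric])
      finally show ?thesis by (simp add: gram)
    qed
    have "complex_of_real (y j) = (\<Sum>i<n. \<Sum>k<n. cnj (u j (\<tau> i)) * A $$ (i, k) * u j (\<tau> k))"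
      unfolding y_def by (rule form)
    also have "\<dots> = (\<Sum>i<n. \<Sum>k<n. cnj (u j (\<tau> (\<tau> i))) * A $$ (\<tau> i, \<tau> k) * u j (\<tau> (\<tau> k)))"
      using sum.reindex_bij_betw[OF bij, of "\<lambda>i. \<Sum>k<n. cnj (u j (\<tau> i)) * A $$ (i, k) * u j (\<tau> k)"]
        sum.reindex_bij_betw[OF bij, of "\<lambda>k. cnj (u j (\<tau> (\<tau> i))) * A $$ (\<tau> i, k) * u j (\<tau> k)" for i]
      by simp
    also have "\<dots> = (\<Sum>i<n. \<Sum>k<n. cnj (u j i) * A $$ (\<tau> i, \<tau> k) * u j k)"
      using flip by (intro sum.cong refl) auto
    finally have Y: "complex_of_real (y j) = (\<Sum>i<n. \<Sum>k<n. cnj (u j i) * A $$ (\<tau> i, \<tau> k) * u j k)" .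
    have X: "complex_of_real (x j) = (\<Sum>i<n. \<Sum>k<n. cnj (u j i) * A $$ (i, k) * u j k)"
      unfolding x_def by (rule form)
    have "complex_of_real ((x j + y j) / 2)
        = (\<Sum>i<n. \<Sum>k<n. cnj (u j i) * ((A $$ (i, k) + A $$ (\<tau> i, \<tau> k)) / 2) * u j k)"
      unfolding of_real_divide of_real_add X Y sum.distrib[symmetric] sum_divide_distrib
      by (intro sum.cong refl) (simp add: algebra_simps)
    also have "\<dots> = (\<Sum>i<n. \<Sum>k<n. cnj (u j i) * (\<Sum>m\<in>M. 1 * V m i * cnj (V m k)) * u j k)"
      by (intro sum.cong refl) (simp add: ens)
    also have "\<dots> = (\<Sum>m\<in>M. 1 * (\<Sum>i<n. V m i * cnj (u j i)) * (\<Sum>k<n. u j k * cnj (V m k)))"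
      by (rule sum_sandwich)
    also have "\<dots> = (\<Sum>m\<in>M. a m j * cnj (a m j))"
      unfolding a_def by (simp add: mult_ac)
    also have "\<dots> = complex_of_real (lam j)" using orth[OF j j] by simp
    finally show ?thesis by (simp only: of_real_eq_iff)
  qed
  have "vn_entropy A \<le> (\<Sum>j<n. (ent (x j) + ent (y j)) / 2)"
    using Sx Sy by (simp add: sum.distrib flip: sum_divide_distrib)
  also have "\<dots> \<le> (\<Sum>j<n. ent (lam j))"
  proof (rule sum_mono)
    fix j assume "j \<in> {..<n}"
    hence j: "j < n" by simp
    \<comment> \<open>Jensen with two equal weights, indexed by the Booleans.\<close>
    have "(\<Sum>b\<in>UNIV. 1 / 2 * ent (if b then x j else y j)) \<le> ent (\<Sum>b\<in>UNIV. 1 / 2 * (if b then x j else y j))"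
      by (rule ent_jensen) (auto simp: x0 y0)
    thus "(ent (x j) + ent (y j)) / 2 \<le> ent (lam j)"
      unfolding UNIV_bool using mid[OF j] by (simp add: field_simps)
  qed
  also have "\<dots> \<le> (\<Sum>m\<in>M. ent (\<Sum>j<n. (cmod (a m j))\<^sup>2))"
    by (rule ensemble_entropy_ge[OF fin orth])
  also have "\<dots> = (\<Sum>m\<in>M. ent (\<Sum>i<n. (cmod (V m i))\<^sup>2))"
    unfolding a_def by (simp add: onb_parseval[OF u])
  finally show ?thesis .
qed

section \<open>The output state\<close>

lemma sum_lessThan_two: "(\<Sum>i<2. f i) = f 0 + f (1 :: nat)" for f :: "nat \<Rightarrow> 'a :: comm_monoid_add"
  by (simp add: numeral_2_eq_2)

lemma sum_lessThan_double:
  fixes f :: "nat \<Rightarrow> 'a :: comm_monoid_add"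
  shows "(\<Sum>j<2 * d. f j) = (\<Sum>s<d. f s) + (\<Sum>s<d. f (d + s))"
proof -
  have "(\<Sum>j<2 * d. f j) = sum f {0..<d} + sum f {d..<d + d}"
    by (simp add: sum.atLeastLessThan_concat mult_2 flip: atLeast0LessThan)
  also have "sum f {d..<d + d} = (\<Sum>s<d. f (d + s))"
    using sum.shift_bounds_nat_ivl[of f 0 d d] by (simp add: atLeast0LessThan add.commute)
  finally show ?thesis by (simp add: atLeast0LessThan)
qed

lemma pure_state_sum:
  assumes "pure_state (2 * d) v"
  shows "(\<Sum>r<d. (cmod (v $ r))\<^sup>2 + (cmod (v $ (d + r)))\<^sup>2) = 1"
  using assms unfolding pure_state_def sum_lessThan_double by (simp add: sum.distrib)

text \<open>For a 2x2 Hermitian matrix, completeness makes the two eigenvectors contribute opposite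
  off-diagonal products, leaving \<open>mu 0 - mu 1\<close> times
  \<open>e 0 0 * cnj (e 0 1)\<close>. The latter has modulus at most \<open>1 / 2\<close> for a unit
  vector.\<close>

lemma two_level_gap:
  fixes e :: "nat \<Rightarrow> nat \<Rightarrow> complex" and mu :: "nat \<Rightarrow> real"
  assumes e: "onb 2 e"
  shows "2 * cmod (\<Sum>k<2. complex_of_real (mu k) * e k 0 * cnj (e k 1)) \<le> \<bar>mu 0 - mu 1\<bar>"
proof -
  have "e 0 0 * cnj (e 0 1) + e 1 0 * cnj (e 1 1) = 0"
    using e unfolding onb_def sum_lessThan_two by auto
  hence e1: "e 1 0 * cnj (e 1 1) = - (e 0 0 * cnj (e 0 1))" by (simp add: eq_neg_iff_add_eq_0 add.commute)
  have "(\<Sum>k<2. complex_of_real (mu k) * e k 0 * cnj (e k 1))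
      = complex_of_real (mu 0) * (e 0 0 * cnj (e 0 1)) + complex_of_real (mu 1) * (e 1 0 * cnj (e 1 1))"
    by (simp add: sum_lessThan_two)
  also have "\<dots> = complex_of_real (mu 0 - mu 1) * (e 0 0 * cnj (e 0 1))"
    unfolding e1 by (simp add: algebra_simps)
  finally have M: "cmod (\<Sum>k<2. complex_of_real (mu k) * e k 0 * cnj (e k 1))
      = \<bar>mu 0 - mu 1\<bar> * (cmod (e 0 0) * cmod (e 0 1))"
    by (simp only: norm_mult norm_of_real complex_mod_cnj)
  have "e 0 0 * cnj (e 0 0) + e 0 1 * cnj (e 0 1) = 1"
    using e unfolding onb_def sum_lessThan_two by auto
  hence "complex_of_real ((cmod (e 0 0))\<^sup>2 + (cmod (e 0 1))\<^sup>2) = complex_of_real 1"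
    unfolding of_real_add complex_norm_square by simp
  hence "(cmod (e 0 0))\<^sup>2 + (cmod (e 0 1))\<^sup>2 = 1" by (simp only: of_real_eq_iff)
  hence "2 * (cmod (e 0 0) * cmod (e 0 1)) \<le> 1"
    using sum_squares_bound[of "cmod (e 0 0)" "cmod (e 0 1)"] by simp
  hence "\<bar>mu 0 - mu 1\<bar> * (2 * (cmod (e 0 0) * cmod (e 0 1))) \<le> \<bar>mu 0 - mu 1\<bar> * 1"
    by (intro mult_left_mono) auto
  thus ?thesis unfolding M by simp
qed

section \<open>The gate in the computational basis\<close>

lemma dim_pauli [simp]: "dim_row (pauli k) = 2" "dim_col (pauli k) = 2"
  by (simp_all add: pauli_def mat_of_rows_list_def)

lemma pauli_index:
  "pauli 0 $$ (0, 0) = 1" "pauli 0 $$ (0, 1) = 0" "pauli 0 $$ (1, 0) = 0" "pauli 0 $$ (1, 1) = 1"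
  "pauli 1 $$ (0, 0) = 0" "pauli 1 $$ (0, 1) = 1" "pauli 1 $$ (1, 0) = 1" "pauli 1 $$ (1, 1) = 0"
  "pauli 2 $$ (0, 0) = 0" "pauli 2 $$ (0, 1) = -\<i>" "pauli 2 $$ (1, 0) = \<i>" "pauli 2 $$ (1, 1) = 0"
  "pauli 3 $$ (0, 0) = 1" "pauli 3 $$ (0, 1) = 0" "pauli 3 $$ (1, 0) = 0" "pauli 3 $$ (1, 1) = -1"
  by (simp_all add: pauli_def mat_of_rows_list_def)

text \<open>The matrix of \<open>c\<^sub>0 I\<otimes>I + c\<^sub>1 X\<otimes>X + c\<^sub>2 (Y\<otimes>Y + Z\<otimes>Z)\<close>, with
  \<open>e = c\<^sub>0 + c\<^sub>2\<close>, \<open>f = c\<^sub>0 - c\<^sub>2\<close>, \<open>g = c\<^sub>1 - c\<^sub>2\<close>, \<open>h = c\<^sub>1 + c\<^sub>2\<close>.\<close>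

definition xmat :: "complex \<Rightarrow> complex \<Rightarrow> complex \<Rightarrow> complex \<Rightarrow> complex mat" where
  "xmat e f g h = mat 4 4 (\<lambda>(i, j).
     if i = j then if i = 0 \<or> i = 3 then e else f
     else if i + j = 3 then if i = 0 \<or> j = 0 then g else h
     else 0)"

lemma pauli_sum_eq_xmat:
  "c0 \<cdot>\<^sub>m kron (pauli 0) (pauli 0) + c1 \<cdot>\<^sub>m kron (pauli 1) (pauli 1)
     + c2 \<cdot>\<^sub>m kron (pauli 2) (pauli 2) + c2 \<cdot>\<^sub>m kron (pauli 3) (pauli 3)
   = xmat (c0 + c2) (c0 - c2) (c1 - c2) (c1 + c2)" (is "?L = ?R")
proof (rule eq_matI)
  have kron: "kron (pauli k) (pauli k) = mat 4 4 (\<lambda>(i, j).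
      pauli k $$ (i div 2, j div 2) * pauli k $$ (i mod 2, j mod 2))" for k
    by (simp add: kron_def)
  fix i j
  assume "i < dim_row ?R" "j < dim_col ?R"
  hence "i < 4" "j < 4" by (auto simp: xmat_def)
  hence "i = 0 \<or> i = 1 \<or> i = 2 \<or> i = 3" "j = 0 \<or> j = 1 \<or> j = 2 \<or> j = 3" by auto
  thus "?L $$ (i, j) = ?R $$ (i, j)"
    unfolding kron xmat_def by (elim disjE) (simp_all add: pauli_index pauli_index[unfolded One_nat_def])
qed (auto simp: xmat_def kron_def)

lemma xmat_amp:
  fixes phi psi :: "complex vec"
  shows "output_amp (xmat e f g h) dA dB phi psi 0 r 0 s
      = e * phi $ r * psi $ s + g * phi $ (dA + r) * psi $ (dB + s)"
    "output_amp (xmat e f g h) dA dB phi psi 0 r 1 s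
      = h * phi $ (dA + r) * psi $ s + f * phi $ r * psi $ (dB + s)"
    "output_amp (xmat e f g h) dA dB phi psi 1 r 0 s
      = f * phi $ (dA + r) * psi $ s + h * phi $ r * psi $ (dB + s)"
    "output_amp (xmat e f g h) dA dB phi psi 1 r 1 s
      = g * phi $ r * psi $ s + e * phi $ (dA + r) * psi $ (dB + s)"
  unfolding output_amp_def sum_lessThan_two xmat_def by simp_all

lemma cnj_self_eq_norm: "z * cnj z = complex_of_real ((cmod z)\<^sup>2)"
  by (rule complex_norm_square[symmetric])

text \<open>The form of Parseval's identity in which the basis enters unconjugated, as it does in
  the coordinates \<open>G\<close> of the input below.\<close>

lemma onb_two_parseval:
  assumes "onb 2 u"
  shows "(\<Sum>k<2. (cmod (\<Sum>b<2. u k b * x b))\<^sup>2) = (cmod (x 0))\<^sup>2 + (cmod (x 1))\<^sup>2"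
proof -
  have "cmod (\<Sum>b<2. u k b * x b) = cmod (\<Sum>b<2. cnj (x b) * cnj (u k b))" for k
  proof -
    have "(\<Sum>b<2. cnj (x b) * cnj (u k b)) = cnj (\<Sum>b<2. u k b * x b)" by (simp add: mult.commute)
    thus ?thesis by (simp only: complex_mod_cnj)
  qed
  thus ?thesis using onb_parseval[OF assms, of "\<lambda>b. cnj (x b)"] by (simp add: sum_lessThan_two)
qed

text \<open>The first four hypotheses say that the outer block with rows \<open>(e, g)\<close>,
  \<open>(g, e)\<close> and the inner block with rows \<open>(f, h)\<close>, \<open>(h, f)\<close>
  are unitary. The number \<open>k\<close> fixes the real part of the off-diagonal entry of
  \<open>M 0\<close> for every input.\<close>

lemma output_entanglement_xmat_le:
  fixes e f g h :: complex and k :: real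
  assumes eg: "(cmod e)\<^sup>2 + (cmod g)\<^sup>2 = 1" and fh: "(cmod f)\<^sup>2 + (cmod h)\<^sup>2 = 1"
    and eg0: "Re (e * cnj g) = 0" and fh0: "Re (f * cnj h) = 0"
    and k: "Re (e * cnj f + g * cnj h) = k" "0 \<le> k"
    and dB: "dB \<ge> 1" and phi: "pure_state (2 * dA) phi" and psi: "pure_state (2 * dB) psi"
  shows "output_entanglement (xmat e f g h) dA dB phi psi \<le> 2 * ent ((1 + k) / 4) + 2 * ent ((1 - k) / 4)"
proof -
  have two_Re: "z + cnj z = complex_of_real (2 * Re z)" for z by (simp add: complex_eq_iff)
  \<comment> \<open>The real hypotheses are restated as complex identities, so that the expansions
    below become polynomial identities in the entries and their conjugates.\<close>
  have E1: "e * cnj e + g * cnj g = 1"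
    unfolding cnj_self_eq_norm of_real_add[symmetric] eg by simp
  have E2: "f * cnj f + h * cnj h = 1"
    unfolding cnj_self_eq_norm of_real_add[symmetric] fh by simp
  have E3: "e * cnj g + cnj e * g = 0" using two_Re[of "e * cnj g"] unfolding eg0 by simp
  have E4: "f * cnj h + cnj f * h = 0" using two_Re[of "f * cnj h"] unfolding fh0 by simp
  have E5: "e * cnj f + g * cnj h + (cnj e * f + cnj g * h) = complex_of_real (2 * k)"
    using two_Re[of "e * cnj f + g * cnj h"] unfolding k(1) by simp

  define p where "p = (\<lambda>r. phi $ r)"
  define q where "q = (\<lambda>r. phi $ (dA + r))"
  define \<psi> where "\<psi> = (\<lambda>\<beta> s. psi $ (\<beta> * dB + s))"
  have pq: "(\<Sum>r<dA. p r * cnj (p r) + q r * cnj (q r)) = 1"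
    unfolding cnj_self_eq_norm p_def q_def using pure_state_sum[OF phi]
    by (simp only: of_real_add[symmetric] of_real_sum[symmetric] of_real_1)
  have \<psi>1: "(\<Sum>s<dB. (cmod (\<psi> 0 s))\<^sup>2 + (cmod (\<psi> 1 s))\<^sup>2) = 1"
    unfolding \<psi>_def using pure_state_sum[OF psi] by simp
  define X where "X = {..<2::nat} \<times> {..<dA}"
  have sumX: "(\<Sum>x\<in>X. F x) = (\<Sum>r<dA. F (0, r) + F (1, r))" for F :: "nat \<times> nat \<Rightarrow> complex"
    unfolding X_def by (simp add: sum.cartesian_product' sum_lessThan_two sum.distrib)
  define amp where "amp = (\<lambda>x b s. output_amp (xmat e f g h) dA dB phi psi (fst x) (snd x) b s)"
  \<comment> \<open>The gate together with the input on \<open>A R_A\<close>, seen as linear maps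
    acting on the input on \<open>B\<close>: \<open>L x\<close> sends the index
    \<open>\<beta>\<close> to the output index \<open>b\<close>, for each outcome \<open>x\<close>
    of the traced-out system.\<close>
  define L where "L = (\<lambda>(a, r) b \<beta>.
      if a = (0::nat) then
        (if b = (0::nat) then (if \<beta> = (0::nat) then e * p r else g * q r)
         else (if \<beta> = 0 then h * q r else f * p r))
      else
        (if b = 0 then (if \<beta> = 0 then f * q r else h * p r)
         else (if \<beta> = 0 then g * p r else e * q r)))"
  have amp: "amp x b s = (\<Sum>\<beta><2. L x b \<beta> * \<psi> \<beta> s)" if "x \<in> X" "b < 2" for x b s
  proof -
    obtain a r where x: "x = (a, r)" by fastforce
    have "a = 0 \<or> a = 1" "b = 0 \<or> b = 1" using that unfolding x X_def by auto
    thus ?thesis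
      unfolding x amp_def sum_lessThan_two L_def \<psi>_def p_def q_def
      by (elim disjE) (simp_all add: xmat_amp xmat_amp[unfolded One_nat_def])
  qed

  \<comment> \<open>Sectors of the Pauli matrix X on B\<close>
  define rt where "rt = complex_of_real (sqrt 2)"
  have rt: "rt * rt = 2" "cnj rt = rt" "rt \<noteq> 0"
    by (simp_all add: rt_def flip: of_real_mult)
  define sg where "sg = (\<lambda>i b. if i = (0::nat) \<or> b = (0::nat) then 1 else (-1 :: complex))"
  \<comment> \<open>\<open>K i\<close> is the component of \<open>L\<close> along
    \<open>(1, sg i 1) / rt\<close>, an eigenvector of X on the output index, and \<open>M i\<close>
    is the Gram matrix of that component.\<close>
  define K where "K = (\<lambda>i x \<beta>. (L x 0 \<beta> + sg i 1 * L x 1 \<beta>) / rt)"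
  define M where "M = (\<lambda>i \<beta> \<gamma>. \<Sum>x\<in>X. K i x \<beta> * cnj (K i x \<gamma>))"
  have half: "(z / rt) * cnj (w / rt) = z * cnj w / 2" for z w
    using rt by (simp add: field_simps)
  \<comment> \<open>The two sectors together give the full Gram matrix, where unitarity leaves the
    norm of the input on \<open>A R_A\<close> on the diagonal and nothing off it.\<close>
  have M_sum: "M 0 \<beta> \<gamma> + M 1 \<beta> \<gamma> = (if \<beta> = \<gamma> then 1 else 0)" if "\<beta> < 2" "\<gamma> < 2" for \<beta> \<gamma>
  proof -
    have "M 0 \<beta> \<gamma> + M 1 \<beta> \<gamma> = (\<Sum>x\<in>X. L x 0 \<beta> * cnj (L x 0 \<gamma>) + L x 1 \<beta> * cnj (L x 1 \<gamma>))"
      unfolding M_def K_def half sum.distrib[symmetric] sg_def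
      by (intro sum.cong refl) (simp add: algebra_simps flip: add_divide_distrib)
    also have "\<dots> = (\<Sum>r<dA. if \<beta> = \<gamma> then p r * cnj (p r) + q r * cnj (q r) else 0)"
      unfolding sumX
    proof (intro sum.cong refl)
      fix r
      let ?S = "\<lambda>\<beta> \<gamma>. L (0, r) 0 \<beta> * cnj (L (0, r) 0 \<gamma>) + L (0, r) 1 \<beta> * cnj (L (0, r) 1 \<gamma>)
          + (L (1, r) 0 \<beta> * cnj (L (1, r) 0 \<gamma>) + L (1, r) 1 \<beta> * cnj (L (1, r) 1 \<gamma>))"
      have "?S 0 0 = (e * cnj e + g * cnj g) * (p r * cnj (p r)) + (f * cnj f + h * cnj h) * (q r * cnj (q r))"
        "?S 0 1 = (e * cnj g + cnj e * g) * (p r * cnj (q r)) + (f * cnj h + cnj f * h) * (q r * cnj (p r))"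
        "?S 1 0 = (e * cnj g + cnj e * g) * (q r * cnj (p r)) + (f * cnj h + cnj f * h) * (p r * cnj (q r))"
        "?S 1 1 = (e * cnj e + g * cnj g) * (q r * cnj (q r)) + (f * cnj f + h * cnj h) * (p r * cnj (p r))"
        unfolding L_def by (simp_all add: algebra_simps)
      moreover have "\<beta> = 0 \<or> \<beta> = 1" "\<gamma> = 0 \<or> \<gamma> = 1" using that by auto
      ultimately show "?S \<beta> \<gamma> = (if \<beta> = \<gamma> then p r * cnj (p r) + q r * cnj (q r) else 0)"
        unfolding E1 E2 E3 E4 by auto
    qed
    also have "\<dots> = (if \<beta> = \<gamma> then 1 else 0)" using pq by simp
    finally show ?thesis .
  qed
  \<comment> \<open>In \<open>Z r + cnj (Z r)\<close> the cross terms of \<open>p\<close> and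
    \<open>q\<close> carry the coefficients of \<open>E3\<close> and \<open>E4\<close> and vanish;
    the rest is \<open>2 * k\<close> times the norm of the input.\<close>
  have M01: "Re (M 0 0 1) = k / 2"
  proof -
    define Z where "Z = (\<lambda>r. (e * p r + h * q r) * cnj (f * p r + g * q r)
        + (f * q r + g * p r) * cnj (h * p r + e * q r))"
    have M0: "M 0 0 1 = (\<Sum>r<dA. Z r) / 2"
      unfolding M_def K_def half sumX sg_def L_def Z_def
      by (simp add: sum_divide_distrib add_divide_distrib add.commute)
    have "Z r + cnj (Z r) = complex_of_real (2 * k) * (p r * cnj (p r) + q r * cnj (q r))" for r
    proof -
      have "Z r + cnj (Z r) = (e * cnj f + g * cnj h + (cnj e * f + cnj g * h)) * (p r * cnj (p r) + q r * cnj (q r))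
          + ((e * cnj g + cnj e * g) + (f * cnj h + cnj f * h)) * (p r * cnj (q r) + q r * cnj (p r))"
        unfolding Z_def complex_cnj_add complex_cnj_mult complex_cnj_cnj
        by (simp only: distrib_left distrib_right mult_ac add_ac)
      thus ?thesis unfolding E3 E4 E5 by simp
    qed
    hence "(\<Sum>r<dA. Z r) + cnj (\<Sum>r<dA. Z r) = complex_of_real (2 * k)"
      unfolding cnj_sum sum.distrib[symmetric] by (simp only: sum_distrib_left[symmetric] pq mult_1_right)
    hence "complex_of_real (2 * Re (\<Sum>r<dA. Z r)) = complex_of_real (2 * k)"
      unfolding two_Re .
    hence "Re (\<Sum>r<dA. Z r) = k" by (simp only: of_real_eq_iff)
    thus ?thesis unfolding M0 by simp
  qed

  \<comment> \<open>Common eigenbasis of the sector matrices\<close>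
  define Mm where "Mm = mat 2 2 (\<lambda>(\<beta>, \<gamma>). M 0 \<beta> \<gamma>)"
  have Mm: "Mm \<in> carrier_mat 2 2" by (simp add: Mm_def)
  have herm: "Mm $$ (i, j) = cnj (Mm $$ (j, i))" if "i < 2" "j < 2" for i j
    using that by (simp add: Mm_def M_def mult.commute)
  obtain u mu where u: "onb 2 u"
    and dec: "\<forall>i<2. \<forall>j<2. Mm $$ (i, j) = (\<Sum>l<2. complex_of_real (mu l) * u l i * cnj (u l j))"
    and "vn_entropy Mm = (\<Sum>l<2. ent (mu l))"
    by (rule hermitian_spectral_decomposition[OF Mm herm])
  \<comment> \<open>Since \<open>M 0\<close> and \<open>M 1\<close> add up to the identity, the
    eigenbasis of \<open>M 0\<close> also diagonalises \<open>M 1\<close>, with eigenvalues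
    \<open>1 - mu l\<close>.\<close>
  define m where "m = (\<lambda>i l. if i = (0::nat) then mu l else 1 - mu l)"
  have Mdec: "M i \<beta> \<gamma> = (\<Sum>l<2. complex_of_real (m i l) * u l \<beta> * cnj (u l \<gamma>))"
    if "i < 2" "\<beta> < 2" "\<gamma> < 2" for i \<beta> \<gamma>
  proof -
    have 0: "M 0 \<beta> \<gamma> = (\<Sum>l<2. complex_of_real (mu l) * u l \<beta> * cnj (u l \<gamma>))"
      using dec that by (simp add: Mm_def)
    have "(\<Sum>l<2. u l \<beta> * cnj (u l \<gamma>)) = (if \<beta> = \<gamma> then 1 else 0)"
      using u that unfolding onb_def by blast
    hence 1: "M 1 \<beta> \<gamma> = (\<Sum>l<2. complex_of_real (1 - mu l) * u l \<beta> * cnj (u l \<gamma>))"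
      using M_sum[of \<beta> \<gamma>] that unfolding 0 by (simp add: algebra_simps sum_subtractf)
    have "i = 0 \<or> i = 1" using that by auto
    thus ?thesis using 0 1 by (auto simp: m_def)
  qed
  \<comment> \<open>Both Gram matrices are positive; taken for \<open>i = 0\<close> and
    \<open>i = 1\<close> this confines \<open>mu l\<close> to the unit interval.\<close>
  have m0: "m i l \<ge> 0" if "i < 2" "l < 2" for i l
  proof -
    have gr: "(\<Sum>x\<in>X. K i x \<beta> * cnj (K i x \<gamma>)) = (\<Sum>l<2. complex_of_real (m i l) * u l \<beta> * cnj (u l \<gamma>))"
      if "\<beta> < 2" "\<gamma> < 2" for \<beta> \<gamma> using Mdec[OF \<open>i < 2\<close> that] by (simp add: M_def)
    show ?thesis using gram_eigenvalue[OF u gr that(2)] by (simp add: sum_nonneg)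
  qed
  have gap: "k \<le> \<bar>mu 0 - mu 1\<bar>"
  proof -
    have "k = 2 * Re (M 0 0 1)" using M01 by simp
    also have "\<dots> \<le> 2 * cmod (M 0 0 1)" by (simp add: complex_Re_le_cmod)
    also have "\<dots> \<le> \<bar>mu 0 - mu 1\<bar>"
      using two_level_gap[OF u, of mu] Mdec[of 0 0 1] by (simp add: m_def)
    finally show ?thesis .
  qed

  \<comment> \<open>Sector amplitudes in the eigenbasis\<close>
  define G where "G = (\<lambda>l s. \<Sum>\<beta><2. u l \<beta> * \<psi> \<beta> s)"
  define t where "t = (\<lambda>i x s. \<Sum>\<beta><2. K i x \<beta> * \<psi> \<beta> s)"
  have t_amp: "t i x s = (amp x 0 s + sg i 1 * amp x 1 s) / rt" if "x \<in> X" for i x s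
    using that unfolding t_def K_def by (simp add: amp sum_lessThan_two add_divide_distrib algebra_simps)
  have t_gram: "(\<Sum>x\<in>X. t i x s * cnj (t i x s')) = (\<Sum>l<2. complex_of_real (m i l) * G l s * cnj (G l s'))"
    if i: "i < 2" for i s s'
  proof -
    have "(\<Sum>x\<in>X. t i x s * cnj (t i x s'))
        = (\<Sum>x\<in>X. 1 * (\<Sum>\<beta><2. K i x \<beta> * \<psi> \<beta> s) * (\<Sum>\<gamma><2. cnj (\<psi> \<gamma> s') * cnj (K i x \<gamma>)))"
      unfolding t_def by (simp add: mult_ac)
    also have "\<dots> = (\<Sum>\<beta><2. \<Sum>\<gamma><2. \<psi> \<beta> s * (\<Sum>x\<in>X. 1 * K i x \<beta> * cnj (K i x \<gamma>)) * cnj (\<psi> \<gamma> s'))"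
      by (rule sum_sandwich[symmetric])
    also have "\<dots> = (\<Sum>\<beta><2. \<Sum>\<gamma><2. \<psi> \<beta> s * (\<Sum>l<2. complex_of_real (m i l) * u l \<beta> * cnj (u l \<gamma>)) * cnj (\<psi> \<gamma> s'))"
      by (intro sum.cong refl) (use Mdec[OF i] in \<open>simp add: M_def\<close>)
    also have "\<dots> = (\<Sum>l<2. complex_of_real (m i l) * (\<Sum>\<beta><2. u l \<beta> * \<psi> \<beta> s) * (\<Sum>\<gamma><2. cnj (\<psi> \<gamma> s') * cnj (u l \<gamma>)))"
      by (rule sum_sandwich)
    also have "\<dots> = (\<Sum>l<2. complex_of_real (m i l) * G l s * cnj (G l s'))"
      unfolding G_def by (simp add: mult_ac)
    finally show ?thesis .
  qed

  \<comment> \<open>The pinched reduced state as an ensemble of four vectors\<close>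
  define A where "A = reduced_BRB (xmat e f g h) dA dB phi psi"
  have A: "A \<in> carrier_mat (2 * dB) (2 * dB)" by (simp add: A_def reduced_BRB_def)
  define T where "T = (\<lambda>x j. amp x (j div dB) (j mod dB))"
  have gram: "A $$ (j, l) = (\<Sum>x\<in>X. T x j * cnj (T x l))" if "j < 2 * dB" "l < 2 * dB" for j l
    using that unfolding A_def reduced_BRB_def T_def amp_def X_def
    by (simp add: sum.cartesian_product')
  \<comment> \<open>The flip of the \<open>B\<close> index in \<open>b * dB + s\<close>, that is,
    conjugation by X on \<open>B\<close>.\<close>
  define \<tau> where "\<tau> = (\<lambda>j. if j < dB then j + dB else j - dB)"
  have \<tau>: "\<tau> j < 2 * dB \<and> \<tau> (\<tau> j) = j" if "j < 2 * dB" for j using that by (auto simp: \<tau>_def)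
  have idx: "j div dB < 2 \<and> \<tau> j div dB = 1 - j div dB \<and> \<tau> j mod dB = j mod dB" if "j < 2 * dB" for j
  proof (cases "j < dB")
    case True
    thus ?thesis by (simp add: \<tau>_def)
  next
    case False
    then obtain s where s: "j = dB + s" using le_Suc_ex not_less by blast
    thus ?thesis using that False dB by (simp add: \<tau>_def)
  qed
  \<comment> \<open>Each vector is the product of the sector vector \<open>(1, sg i 1)\<close> on
    \<open>B\<close> and \<open>G l\<close> on \<open>R_B\<close>. The \<open>1 / 2\<close> under
    the root compensates the squared norm 2 of the sector vector, so the weight is
    \<open>m i l\<close> times the squared norm of \<open>G l\<close>.\<close>
  define V where "V = (\<lambda>(i, l) j. complex_of_real (sqrt (m i l / 2)) * sg i (j div dB) * G l (j mod dB))"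
  define N where "N = {..<2::nat} \<times> {..<2::nat}"
  have sumN: "(\<Sum>x\<in>N. F x) = (\<Sum>i<2. \<Sum>l<2. F (i, l))" for F :: "nat \<times> nat \<Rightarrow> 'b :: comm_monoid_add"
    unfolding N_def by (simp add: sum.cartesian_product')
  have ens: "(A $$ (j, l) + A $$ (\<tau> j, \<tau> l)) / 2 = (\<Sum>x\<in>N. V x j * cnj (V x l))"
    if j: "j < 2 * dB" and l: "l < 2 * dB" for j l
  proof -
    define b s b' s' where bs: "b = j div dB" "s = j mod dB" "b' = l div dB" "s' = l mod dB"
    have b: "b = 0 \<or> b = 1" "b' = 0 \<or> b' = 1" using idx[OF j] idx[OF l] unfolding bs by auto
    have VV: "V (i, r) j * cnj (V (i, r) l)
        = sg i b * sg i b' / 2 * (complex_of_real (m i r) * G r s * cnj (G r s'))" if "i < 2" "r < 2" for i r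
    proof -
      have sq: "complex_of_real (sqrt (m i r / 2)) * complex_of_real (sqrt (m i r / 2)) = complex_of_real (m i r) / 2"
        using m0[OF that] by (simp flip: of_real_mult)
      have sgc: "cnj (sg i b') = sg i b'" by (simp add: sg_def)
      have VV: "V (i, r) j * cnj (V (i, r) l)
          = (complex_of_real (sqrt (m i r / 2)) * complex_of_real (sqrt (m i r / 2)))
            * (sg i b * cnj (sg i b')) * (G r s * cnj (G r s'))"
        unfolding V_def bs[symmetric] prod.case complex_cnj_mult complex_cnj_complex_of_real
        by (simp only: mult_ac)
      show ?thesis unfolding VV sq sgc by (simp add: mult_ac)
    qed
    have "(\<Sum>x\<in>N. V x j * cnj (V x l)) = (\<Sum>i<2. sg i b * sg i b' / 2 * (\<Sum>r<2. complex_of_real (m i r) * G r s * cnj (G r s')))"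
      unfolding sumN by (simp add: VV sum_distrib_left)
    also have "\<dots> = (\<Sum>i<2. sg i b * sg i b' / 2 * (\<Sum>x\<in>X. t i x s * cnj (t i x s')))"
      by (intro sum.cong refl) (simp add: t_gram)
    also have "\<dots> = (\<Sum>x\<in>X. \<Sum>i<2. sg i b * sg i b' / 2 * (t i x s * cnj (t i x s')))"
      unfolding sum_distrib_left by (rule sum.swap)
    \<comment> \<open>Orthogonality of the signs: the sum over \<open>i\<close> keeps only the
      products of amplitudes whose two \<open>B\<close> indices are \<open>(b, b')\<close> or are
      both flipped, which is the average over \<open>\<tau>\<close>.\<close>
    also have "\<dots> = (\<Sum>x\<in>X. (amp x b s * cnj (amp x b' s') + amp x (1 - b) s * cnj (amp x (1 - b') s')) / 2)"
    proof (intro sum.cong refl)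
      fix x assume x: "x \<in> X"
      show "(\<Sum>i<2. sg i b * sg i b' / 2 * (t i x s * cnj (t i x s')))
         = (amp x b s * cnj (amp x b' s') + amp x (1 - b) s * cnj (amp x (1 - b') s')) / 2"
      proof -
        have same: "1 * 1 / 2 * ((z + 1 * w) * (z' + 1 * w') / 2) + 1 / 2 * ((z + - 1 * w) * (z' + - 1 * w') / 2)
            = (z * z' + w * w') / 2"
          and diff: "1 * 1 / 2 * ((z + 1 * w) * (z' + 1 * w') / 2) + - 1 / 2 * ((z + - 1 * w) * (z' + - 1 * w') / 2)
            = (z * w' + w * z') / 2" for z w z' w' :: complex
          by (simp_all add: field_simps)
        show ?thesis
          unfolding sum_lessThan_two t_amp[OF x] half sg_def using b
            same[of "amp x 0 s" "amp x 1 s" "cnj (amp x 0 s')" "cnj (amp x 1 s')"]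
            diff[of "amp x 0 s" "amp x 1 s" "cnj (amp x 0 s')" "cnj (amp x 1 s')"]
          by (elim disjE) (simp_all add: add.commute)
      qed
    qed
    also have "\<dots> = (A $$ (j, l) + A $$ (\<tau> j, \<tau> l)) / 2"
      using gram[OF j l] gram[of "\<tau> j" "\<tau> l"] \<tau>[OF j] \<tau>[OF l] idx[OF j] idx[OF l]
      by (simp add: T_def bs sum.distrib flip: sum_divide_distrib)
    finally show ?thesis ..
  qed
  \<comment> \<open>The weights of the input on \<open>B R_B\<close> along the two eigenvectors;
    they sum to 1 by Parseval.\<close>
  define R where "R = (\<lambda>l. \<Sum>s<dB. (cmod (G l s))\<^sup>2)"
  have R0: "R l \<ge> 0" for l by (simp add: R_def sum_nonneg)
  have R1: "R 0 + R 1 = 1"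
  proof -
    have "R 0 + R 1 = (\<Sum>s<dB. \<Sum>l<2. (cmod (G l s))\<^sup>2)"
      by (simp add: R_def sum_lessThan_two sum.distrib)
    thus ?thesis unfolding G_def onb_two_parseval[OF u] using \<psi>1 by simp
  qed
  have V_norm: "(\<Sum>j<2 * dB. (cmod (V (i, l) j))\<^sup>2) = m i l * R l" if "i < 2" "l < 2" for i l
  proof -
    have sg1: "cmod (sg i b) = 1" for b by (simp add: sg_def)
    have Vj: "(cmod (V (i, l) j))\<^sup>2 = m i l / 2 * (cmod (G l (j mod dB)))\<^sup>2" for j
      unfolding V_def prod.case norm_mult sg1 using m0[OF that] by (simp add: power_mult_distrib)
    show ?thesis unfolding sum_lessThan_double R_def Vj by (simp add: sum_distrib_left)
  qed
  have "output_entanglement (xmat e f g h) dA dB phi psi = vn_entropy A"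
    by (simp add: output_entanglement_def A_def)
  also have "\<dots> \<le> (\<Sum>x\<in>N. ent (\<Sum>j<2 * dB. (cmod (V x j))\<^sup>2))"
    by (rule vn_entropy_le_pinched_ensemble[OF A gram \<tau> _ ens]) (simp_all add: N_def)
  also have "\<dots> = (\<Sum>i<2. \<Sum>l<2. ent (m i l * R l))"
    unfolding sumN by (simp add: V_norm)
  also have "\<dots> = ent (mu 0 * R 0) + ent ((1 - mu 0) * R 0) + ent (mu 1 * R 1) + ent ((1 - mu 1) * R 1)"
    by (simp add: sum_lessThan_two m_def)
  also have "\<dots> \<le> 2 * ent ((1 + k) / 4) + 2 * ent ((1 - k) / 4)"
    using m0[of 0 0] m0[of 0 1] m0[of 1 0] m0[of 1 1] R0 R1 gap k(2)
    by (intro pinched_entropy_le) (simp_all add: m_def)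
  finally show ?thesis .
qed

text \<open>The outer pair of indices 0, 3 and the inner pair 1, 2 decouple into blocks with equal
  diagonal and equal off-diagonal entries, whose eigenvectors are sums and differences of basis
  vectors.\<close>

lemma vn_entropy_xmat:
  fixes a a' b b' :: real
  shows "vn_entropy (xmat a a' b b') = ent (a + b) + ent (a' + b') + ent (a' - b') + ent (a - b)"
proof -
  define w where "w = complex_of_real (1 / sqrt 2)"
  have w: "w * w = 1 / 2" "cnj w = w" by (simp_all add: w_def flip: of_real_mult)
  have w2: "w * (w * 2) = 1" using w(1) by (simp add: mult.assoc[symmetric])
  \<comment> \<open>Real, symmetric and involutive, hence its own adjoint and inverse; columns 0 and
    1 hold the sums, columns 3 and 2 the corresponding differences.\<close>
  define P where "P = mat 4 4 (\<lambda>(i, j). if i = j then if i < 2 then w else - w else if i + j = 3 then w else 0)"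
  define d :: "nat \<Rightarrow> real" where "d = (\<lambda>i. if i = 0 then a + b else if i = 1 then a' + b' else if i = 2 then a' - b' else a - b)"
  define D where "D = mat 4 4 (\<lambda>(i, j). if i = j then complex_of_real (d i) else 0)"
  have sum4: "(\<Sum>i = 0..<4. F i) = F 0 + F 1 + F 2 + F 3" for F :: "nat \<Rightarrow> 'b :: comm_monoid_add"
    by (simp add: eval_nat_numeral)
  have four: "i = 0 \<or> i = 1 \<or> i = 2 \<or> i = 3" if "i < 4" for i :: nat using that by auto
  have P: "P \<in> carrier_mat 4 4" and D: "D \<in> carrier_mat 4 4" by (simp_all add: P_def D_def)
  have adjP: "adj P = P"
    by (rule eq_matI) (auto simp: P_def w)
  have PP: "P * P = 1\<^sub>m 4"
  proof (rule eq_matI)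
    fix i j assume "i < dim_row (1\<^sub>m 4 :: complex mat)" "j < dim_col (1\<^sub>m 4 :: complex mat)"
    hence "i < 4" "j < 4" by auto
    from four[OF this(1)] four[OF this(2)] show "(P * P) $$ (i, j) = 1\<^sub>m 4 $$ (i, j)"
      by (elim disjE) (simp_all add: P_def scalar_prod_def sum4 w)
  qed (simp_all add: P_def)
  have PD: "P * D = mat 4 4 (\<lambda>(i, j). P $$ (i, j) * d j)"
  proof (rule eq_matI)
    fix i j assume "i < dim_row (mat 4 4 (\<lambda>(i, j). P $$ (i, j) * d j))" "j < dim_col (mat 4 4 (\<lambda>(i, j). P $$ (i, j) * d j))"
    hence i: "i < 4" and j: "j < 4" by auto
    from four[OF j] show "(P * D) $$ (i, j) = mat 4 4 (\<lambda>(i, j). P $$ (i, j) * d j) $$ (i, j)"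
      using i j P D by (elim disjE) (simp_all add: D_def scalar_prod_def sum4)
  qed (use P D in auto)
  have "xmat a a' b b' = P * D * P"
  proof (rule eq_matI)
    fix i j assume "i < dim_row (P * D * P)" "j < dim_col (P * D * P)"
    hence "i < 4" "j < 4" by (auto simp: P_def)
    from four[OF this(1)] four[OF this(2)] show "xmat a a' b b' $$ (i, j) = (P * D * P) $$ (i, j)"
      unfolding PD
      by (elim disjE) (simp_all add: P_def xmat_def scalar_prod_def sum4 d_def algebra_simps w w2)
  qed (simp_all add: P_def xmat_def)
  hence "vn_entropy (xmat a a' b b') = (\<Sum>j<4. ent (Re (D $$ (j, j))))"
    by (intro vn_entropy_unitary_diag[OF P D]) (auto simp: adjP PP diagonal_mat_def D_def)
  thus ?thesis by (simp add: D_def d_def sum4 flip: atLeast0LessThan)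
qed

text \<open>With maximally entangled inputs the ancillas copy the input indices, so the amplitudes
  are the entries of the gate divided by 2, and tracing out again gives a matrix of the same X
  shape.\<close>

lemma reduced_BRB_bell:
  "reduced_BRB (xmat e f g h) 2 2 bell bell
     = xmat (complex_of_real (((cmod e)\<^sup>2 + (cmod f)\<^sup>2) / 4)) (complex_of_real (((cmod g)\<^sup>2 + (cmod h)\<^sup>2) / 4))
         (complex_of_real (Re (e * cnj f) / 2)) (complex_of_real (Re (g * cnj h) / 2))" (is "?L = ?R")
proof (rule eq_matI)
  define w where "w = complex_of_real (1 / sqrt 2)"
  have w: "w * w = 1 / 2" "cnj w = w" by (simp_all add: w_def flip: of_real_mult)
  have bell: "bell $ 0 = w" "bell $ Suc 0 = 0" "bell $ 2 = 0" "bell $ 3 = w"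
      "bell $ Suc (Suc 0) = 0" "bell $ Suc (Suc (Suc 0)) = w"
    by (simp_all add: bell_def w_def)
  let ?a = "output_amp (xmat e f g h) 2 2 bell bell"
  have amp: "?a 0 0 0 0 = e / 2" "?a 0 0 0 1 = 0" "?a 0 0 1 0 = 0" "?a 0 0 1 1 = f / 2"
      "?a 0 1 0 0 = 0" "?a 0 1 0 1 = g / 2" "?a 0 1 1 0 = h / 2" "?a 0 1 1 1 = 0"
      "?a 1 0 0 0 = 0" "?a 1 0 0 1 = h / 2" "?a 1 0 1 0 = g / 2" "?a 1 0 1 1 = 0"
      "?a 1 1 0 0 = f / 2" "?a 1 1 0 1 = 0" "?a 1 1 1 0 = 0" "?a 1 1 1 1 = e / 2"
    unfolding xmat_amp by (simp_all add: bell w mult.assoc)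
  have re: "complex_of_real (Re z / 2) = (z + cnj z) / 4" for z by (simp add: complex_eq_iff)
  have four: "i = 0 \<or> i = 1 \<or> i = 2 \<or> i = 3" if "i < 4" for i :: nat using that by auto
  fix i j assume "i < dim_row ?R" "j < dim_col ?R"
  hence "i < 4" "j < 4" by (auto simp: xmat_def)
  from four[OF this(1)] four[OF this(2)] show "?L $$ (i, j) = ?R $$ (i, j)"
    unfolding reduced_BRB_def re unfolding of_real_divide of_real_add complex_norm_square xmat_def[of "_ / _"]
    by (elim disjE)
       (simp_all add: sum_lessThan_two amp amp[unfolded One_nat_def] add_divide_distrib)
qed (simp_all add: xmat_def reduced_BRB_def)

lemma pure_state_bell: "pure_state 4 bell"
proof -
  have "(\<Sum>i<4. (cmod (bell $ i))\<^sup>2) = (\<Sum>i\<in>{0, 1, 2, 3}. (cmod (bell $ i))\<^sup>2)"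
    by (intro sum.cong) auto
  also have "\<dots> = 1" by (simp add: bell_def norm_divide power_divide)
  finally show ?thesis by (simp add: pure_state_def bell_def)
qed

theorem theorem3:
  fixes y :: real and c :: "nat \<Rightarrow> complex" and U :: "complex mat"
  assumes "0 < y" and "y < pi / 4"
    and "c 0 = (complex_of_real ((cos y)\<^sup>2) + \<i> * complex_of_real ((sin y)\<^sup>2)) / complex_of_real (sqrt 2)"
    and "c 1 = (complex_of_real ((sin y)\<^sup>2) + \<i> * complex_of_real ((cos y)\<^sup>2)) / complex_of_real (sqrt 2)"
    and "c 2 = (1 + \<i>) * complex_of_real (sin y * cos y) / complex_of_real (sqrt 2)"
    and "c 3 = (1 + \<i>) * complex_of_real (sin y * cos y) / complex_of_real (sqrt 2)"
    and "U = c 0 \<cdot>\<^sub>m kron (pauli 0) (pauli 0) + c 1 \<cdot>\<^sub>m kron (pauli 1) (pauli 1)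
           + c 2 \<cdot>\<^sub>m kron (pauli 2) (pauli 2) + c 3 \<cdot>\<^sub>m kron (pauli 3) (pauli 3)"
  shows "(shannon_entropy [(cmod (c 0))\<^sup>2, (cmod (c 0))\<^sup>2, (cmod (c 2))\<^sup>2, (cmod (c 2))\<^sup>2]) \<in> entangling_values U
       \<and> (\<forall>e \<in> entangling_values U. e \<le> shannon_entropy [(cmod (c 0))\<^sup>2, (cmod (c 0))\<^sup>2, (cmod (c 2))\<^sup>2, (cmod (c 2))\<^sup>2])
       \<and> entangling_power U
           = shannon_entropy [(cmod (c 0))\<^sup>2, (cmod (c 0))\<^sup>2, (cmod (c 2))\<^sup>2, (cmod (c 2))\<^sup>2]
       \<and> shannon_entropy [(cmod (c 0))\<^sup>2, (cmod (c 0))\<^sup>2, (cmod (c 2))\<^sup>2, (cmod (c 2))\<^sup>2]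
           = shannon_entropy [((cos y)^4 + (sin y)^4) / 2, ((cos y)^4 + (sin y)^4) / 2,
                              (sin y)\<^sup>2 * (cos y)\<^sup>2, (sin y)\<^sup>2 * (cos y)\<^sup>2]
       \<and> output_entanglement U 2 2 bell bell
           = shannon_entropy [(cmod (c 0))\<^sup>2, (cmod (c 0))\<^sup>2, (cmod (c 2))\<^sup>2, (cmod (c 2))\<^sup>2]"
proof -
  define a b where ab: "a = cos y" "b = sin y"
  have ab1: "a\<^sup>2 + b\<^sup>2 = 1" by (simp add: ab)
  have c3: "c 3 = c 2" using assms(5,6) by simp
  define e f g h where efgh: "e = c 0 + c 2" "f = c 0 - c 2" "g = c 1 - c 2" "h = c 1 + c 2"
  have U: "U = xmat e f g h"
    using assms(7) unfolding c3 pauli_sum_eq_xmat efgh .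
  \<comment> \<open>This is the square of \<open>cos (2 * y)\<close>, the eigenvalue gap forced by
    the gate.\<close>
  define k where "k = (a\<^sup>2 - b\<^sup>2)\<^sup>2"
  have c: "Re (c 0) = a\<^sup>2 / sqrt 2" "Im (c 0) = b\<^sup>2 / sqrt 2"
      "Re (c 1) = b\<^sup>2 / sqrt 2" "Im (c 1) = a\<^sup>2 / sqrt 2"
      "Re (c 2) = b * a / sqrt 2" "Im (c 2) = b * a / sqrt 2"
    unfolding assms(3-5) ab[symmetric] by simp_all
  have parts: "Re e = a * (a + b) / sqrt 2" "Im e = b * (a + b) / sqrt 2"
      "Re f = a * (a - b) / sqrt 2" "Im f = b * (b - a) / sqrt 2"
      "Re g = b * (b - a) / sqrt 2" "Im g = a * (a - b) / sqrt 2"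
      "Re h = b * (a + b) / sqrt 2" "Im h = a * (a + b) / sqrt 2"
    unfolding efgh plus_complex.sel minus_complex.sel c by (simp_all add: power2_eq_square algebra_simps add_divide_distrib diff_divide_distrib)
  have sq2: "(x / sqrt 2) * (x' / sqrt 2) = x * x' / 2" for x x' by simp
  have norms: "(cmod e)\<^sup>2 = (a\<^sup>2 + b\<^sup>2) * (a + b)\<^sup>2 / 2" "(cmod f)\<^sup>2 = (a\<^sup>2 + b\<^sup>2) * (a - b)\<^sup>2 / 2"
      "(cmod g)\<^sup>2 = (a\<^sup>2 + b\<^sup>2) * (a - b)\<^sup>2 / 2" "(cmod h)\<^sup>2 = (a\<^sup>2 + b\<^sup>2) * (a + b)\<^sup>2 / 2"
    unfolding cmod_power2 parts unfolding power2_eq_square sq2 by (simp_all add: field_simps)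
  have dots: "Re (e * cnj g) = 0" "Re (f * cnj h) = 0" "Re (e * cnj f) = k / 2" "Re (g * cnj h) = k / 2"
    unfolding times_complex.sel cnj.sel parts k_def minus_mult_right[symmetric] diff_minus_eq_add sq2
    by (simp_all add: field_simps power2_eq_square)
  have sum_sq: "(a + b)\<^sup>2 / 2 + (a - b)\<^sup>2 / 2 = 1"
    using ab1 by (simp add: power2_sum power2_diff field_simps)
  have normsum: "(cmod e)\<^sup>2 + (cmod g)\<^sup>2 = 1" "(cmod f)\<^sup>2 + (cmod h)\<^sup>2 = 1"
      "(cmod e)\<^sup>2 + (cmod f)\<^sup>2 = 1" "(cmod g)\<^sup>2 + (cmod h)\<^sup>2 = 1"
    unfolding norms ab1 using sum_sq by simp_all
  \<comment> \<open>Homogenisation: with 1 written as a form of degree four, the two identities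
    below are polynomial identities in \<open>a\<close> and \<open>b\<close>.\<close>
  have one: "1 = (a\<^sup>2 + b\<^sup>2)\<^sup>2" using ab1 by simp
  have p: "(1 + k) / 4 = (a ^ 4 + b ^ 4) / 2" and q: "(1 - k) / 4 = b\<^sup>2 * a\<^sup>2"
    unfolding k_def by (subst one, simp add: power2_eq_square power4_eq_xxxx field_simps)+
  have c0: "(cmod (c 0))\<^sup>2 = (1 + k) / 4" and c2: "(cmod (c 2))\<^sup>2 = (1 - k) / 4"
    unfolding p q cmod_power2 c by (simp_all add: power2_eq_square power4_eq_xxxx field_simps)
  define H where "H = shannon_entropy [(cmod (c 0))\<^sup>2, (cmod (c 0))\<^sup>2, (cmod (c 2))\<^sup>2, (cmod (c 2))\<^sup>2]"
  have H: "H = 2 * ent ((1 + k) / 4) + 2 * ent ((1 - k) / 4)"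
    unfolding H_def c0 c2 by (simp add: shannon_entropy_def ent_def)
  have bell: "output_entanglement U 2 2 bell bell = H"
  proof -
    \<comment> \<open>The eigenvalues are \<open>(1 + k) / 4\<close> and \<open>(1 - k) / 4\<close>,
      each twice, and these are the squared moduli of \<open>c 0\<close> and
      \<open>c 2\<close>.\<close>
    have "reduced_BRB U 2 2 bell bell = xmat (complex_of_real (1 / 4)) (complex_of_real (1 / 4))
        (complex_of_real (k / 4)) (complex_of_real (k / 4))"
      unfolding U reduced_BRB_bell normsum dots by simp
    thus ?thesis unfolding output_entanglement_def H
      by (simp only: vn_entropy_xmat) (simp add: add_divide_distrib diff_divide_distrib)
  qed
  have mem: "H \<in> entangling_values U"
    unfolding entangling_values_def
    by (rule CollectI, rule exI[of _ 2], rule exI[of _ 2], rule exI[of _ bell], rule exI[of _ bell])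
       (simp add: bell pure_state_bell)
  have ub: "x \<le> H" if "x \<in> entangling_values U" for x
  proof -
    obtain dA dB phi psi where x: "x = output_entanglement U dA dB phi psi" and d: "dB \<ge> 1"
      and st: "pure_state (2 * dA) phi" "pure_state (2 * dB) psi"
      using \<open>x \<in> entangling_values U\<close> unfolding entangling_values_def by blast
    have "Re (e * cnj f + g * cnj h) = k" unfolding plus_complex.sel dots by simp
    moreover have "0 \<le> k" by (simp add: k_def)
    ultimately show ?thesis unfolding x U H
      by (rule output_entanglement_xmat_le[OF normsum(1,2) dots(1,2) _ _ d st])
  qed
  have sup: "entangling_power U = H"
    unfolding entangling_power_def by (rule cSup_eq_maximum[OF mem ub])
  have alt: "H = shannon_entropy [((cos y)^4 + (sin y)^4) / 2, ((cos y)^4 + (sin y)^4) / 2,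
      (sin y)\<^sup>2 * (cos y)\<^sup>2, (sin y)\<^sup>2 * (cos y)\<^sup>2]"
    unfolding H_def c0 c2 p q ab ..
  show ?thesis
    using mem ub sup alt bell unfolding H_def by blast
qed

end
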